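(* Let $E$ be the exceptional divisor of the blow-up $\widetilde{\mathbb C^2}_0$ of $\mathbb C^2$ at the origin, and let $\mathcal B^+_{\mathbb R}(E)$ be the boundary of the real oriented blow-up of $\widetilde{\mathbb C^2}_0$ along $E$, parametrized by the two charts $(v_1,\theta_1)$ and $(v_2,\theta_2)$ described in the context. The mapping $S^3\to\mathcal B^+_{\mathbb R}(E)$, where $S^3=\{(z_1,z_2)\in\mathbb C^2:|z_1|^2+|z_2|^2=1\}$, given by $$(z_1,z_2)\mapsto\begin{cases} v_1=\dfrac{z_2}{z_1},\ \theta_1=\arg z_1 & \text{if } z_1\ne0,\\[2mm] v_2=\dfrac{z_1}{z_2},\ \theta_2=\arg z_2&\text{if } z_2\neq0,\end{cases}$$ is a diffeomorphism which takes the orientation of $S^3$ as the boundary of the unit ball in $\mathbb R^4$ to the chosen orientation of $\mathcal B^+_{\mathbb R}(E)$, and which transforms the Hopf circle action $\Theta*(z_1,z_2)=(e^{i\Theta}z_1,e^{i\Theta}z_2)$ into the canonical circle action $\Theta*(v_j,\theta_j)=(v_j,\theta_j+\Theta)$ on $\mathcal B^+_{\mathbb R}(E)$.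
   Context: $\widetilde{\mathbb C^2}_0$ is covered by two charts with coordinates $(u_1,v_1)$, $u_1=x,\ v_1=y/x$, and $(u_2,v_2)$, $u_2=y,\ v_2=x/y$; in each, $E=\{u_j=0\}$. The real oriented blow-up $\mathcal B^+_{\mathbb R}(\widetilde{\mathbb C^2}_0,E)$ is, in each chart, the closure of $\{(u_j,v_j,\theta_j)\in\mathbb C^*\times\mathbb C\times\mathbb R/2\pi\mathbb Z: u_j/|u_j|=e^{i\theta_j}\}$ in $\mathbb C\times\mathbb C\times\mathbb R/2\pi\mathbb Z$; it is a 4-manifold with boundary $\mathcal B^+_{\mathbb R}(E)$, given by $u_j=0$. So $\mathcal B^+_{\mathbb R}(E)$ is covered by the two charts $(v_j,\theta_j)\in\mathbb C\times\mathbb R/2\pi\mathbb Z$, $j=1,2$, with $v_2=1/v_1$, $\theta_2=\theta_1+\arg v_1$ on the overlap. Chosen orientation: $\mathcal B^+_{\mathbb R}(E)$ is given the opposite of its orientation as boundary of the (complex-oriented) manifold $\mathcal B^+_{\mathbb R}(\widetilde{\mathbb C^2}_0,E)$; i.e. it is oriented as the boundary of a tubular neighborhood of $E$. *)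

theory Defs
  imports "HOL-Analysis.Analysis"
begin

section \<open>Smooth maps and oriented atlases\<close>

primrec Ck_on :: "nat \<Rightarrow> ('a::euclidean_space \<Rightarrow> 'b::real_normed_vector) \<Rightarrow> 'a set \<Rightarrow> bool" where
  "Ck_on 0 f S \<longleftrightarrow> continuous_on S f"
| "Ck_on (Suc k) f S \<longleftrightarrow> (\<forall>x\<in>S. f differentiable (at x)) \<and>
     (\<forall>v. Ck_on k (\<lambda>x. frechet_derivative f (at x) v) S)"

text \<open>Only used for open \<open>S\<close>.\<close>
definition smooth_on :: "('a::euclidean_space \<Rightarrow> 'b::real_normed_vector) \<Rightarrow> 'a set \<Rightarrow> bool" where
  "smooth_on f S \<longleftrightarrow> (\<forall>k. Ck_on k f S)"

type_synonym ('p, 'n) chart = "'p set \<times> ('p \<Rightarrow> real ^ 'n)"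

definition rep_dom :: "('p, 'n) chart \<Rightarrow> ('q, 'm) chart \<Rightarrow> ('p \<Rightarrow> 'q) \<Rightarrow> (real ^ 'n) set" where
  "rep_dom c d f = snd c ` (fst c \<inter> f -` fst d)"

definition local_rep ::
  "('p, 'n) chart \<Rightarrow> ('q, 'm) chart \<Rightarrow> ('p \<Rightarrow> 'q) \<Rightarrow> real ^ 'n \<Rightarrow> real ^ 'm" where
  "local_rep c d f = snd d \<circ> f \<circ> the_inv_into (fst c) (snd c)"

text \<open>The atlases carry the topology; openness of all \<open>rep_dom c d f\<close> expresses continuity of \<open>f\<close>.\<close>
definition smooth_map ::
  "('p, 'n::finite) chart set \<Rightarrow> ('q, 'm::finite) chart set \<Rightarrow> ('p \<Rightarrow> 'q) \<Rightarrow> bool" where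
  "smooth_map A B f \<longleftrightarrow>
     (\<forall>c\<in>A. \<forall>d\<in>B. open (rep_dom c d f) \<and> smooth_on (local_rep c d f) (rep_dom c d f))"

definition orientation_preserving ::
  "('p, 'n::finite) chart set \<Rightarrow> ('q, 'n) chart set \<Rightarrow> ('p \<Rightarrow> 'q) \<Rightarrow> bool" where
  "orientation_preserving A B f \<longleftrightarrow>
     (\<forall>c\<in>A. \<forall>d\<in>B. \<forall>x\<in>rep_dom c d f.
        det (matrix (frechet_derivative (local_rep c d f) (at x))) > 0)"

definition oriented_atlas :: "'p set \<Rightarrow> ('p, 'n::finite) chart set \<Rightarrow> bool" where
  "oriented_atlas M A \<longleftrightarrow>
     \<Union>(fst ` A) = M \<and> (\<forall>c\<in>A. inj_on (snd c) (fst c)) \<and>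
     smooth_map A A id \<and> orientation_preserving A A id"

definition diffeomorphism ::
  "'p set \<Rightarrow> ('p, 'n::finite) chart set \<Rightarrow> 'q set \<Rightarrow> ('q, 'm::finite) chart set \<Rightarrow>
   ('p \<Rightarrow> 'q) \<Rightarrow> bool" where
  "diffeomorphism M A N B f \<longleftrightarrow>
     bij_betw f M N \<and> smooth_map A B f \<and> smooth_map B A (inv_into M f)"

definition opposite_atlas :: "('p, 3) chart set \<Rightarrow> ('p, 3) chart set" where
  "opposite_atlas A =
     (\<lambda>(U, \<phi>). (U, \<lambda>p. vector [- (\<phi> p $ 1), \<phi> p $ 2, \<phi> p $ 3])) ` A"

text \<open>Charts of a 4-manifold with boundary take values in the half-space \<open>x\<^sub>1 \<le> 0\<close>. There
  \<open>\<partial>/\<partial>x\<^sub>1\<close> points outwards, so by the rule ``outward normal first'' an oriented chart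
  \<open>(x\<^sub>1, x\<^sub>2, x\<^sub>3, x\<^sub>4)\<close> restricts to an oriented chart \<open>(x\<^sub>2, x\<^sub>3, x\<^sub>4)\<close> of the boundary.\<close>
definition half_space :: "(real ^ 4) set" where
  "half_space = {x. x $ 1 \<le> 0}"

definition boundary_atlas :: "('p, 4) chart set \<Rightarrow> ('p, 3) chart set" where
  "boundary_atlas A =
     (\<lambda>(U, \<phi>). ({p \<in> U. \<phi> p $ 1 = 0}, \<lambda>p. vector [\<phi> p $ 2, \<phi> p $ 3, \<phi> p $ 4])) ` A"

section \<open>The 3-sphere as the oriented boundary of the unit ball\<close>

fun c2_coords :: "complex \<times> complex \<Rightarrow> real ^ 4" where
  "c2_coords (z, w) = vector [Re z, Im z, Re w, Im w]"

text \<open>The oriented atlas of a domain \<open>D\<close> with smooth boundary in \<open>\<complex>\<^sup>2 = \<real>\<^sup>4\<close>: restrictions to \<open>D\<close> of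
  orientation-preserving diffeomorphisms \<open>\<Phi>\<close> between open subsets of \<open>\<real>\<^sup>4\<close> that straighten \<open>D\<close>
  to the half-space.\<close>
definition domain_atlas :: "(complex \<times> complex) set \<Rightarrow> (complex \<times> complex, 4) chart set" where
  "domain_atlas D = {(W \<inter> D, \<Phi>) | W \<Phi>.
     open W \<and> oriented_atlas W {(W, c2_coords), (W, \<Phi>)} \<and>
     \<Phi> ` (W \<inter> D) = \<Phi> ` W \<inter> half_space}"

definition S3 :: "(complex \<times> complex) set" where
  "S3 = {(z1, z2). (cmod z1)\<^sup>2 + (cmod z2)\<^sup>2 = 1}"

definition S3_atlas :: "(complex \<times> complex, 3) chart set" where
  "S3_atlas = boundary_atlas (domain_atlas (cball 0 1))"

section \<open>Angles\<close>

definition angle_rel :: "real \<Rightarrow> real \<Rightarrow> bool" where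
  "angle_rel x y \<longleftrightarrow> (\<exists>k::int. y - x = 2 * pi * of_int k)"

lemma equivp_angle_rel: "equivp angle_rel"
proof (rule equivpI)
  show "reflp angle_rel"
    by (auto simp: reflp_def angle_rel_def intro: exI[of _ 0])
  show "symp angle_rel"
    unfolding symp_def angle_rel_def
  proof (intro allI impI)
    fix x y :: real assume "\<exists>k::int. y - x = 2 * pi * of_int k"
    then obtain k :: int where "y - x = 2 * pi * of_int k" by blast
    then have "x - y = 2 * pi * of_int (- k)" by simp
    then show "\<exists>k::int. x - y = 2 * pi * of_int k" by blast
  qed
  show "transp angle_rel"
    unfolding transp_def angle_rel_def
  proof (intro allI impI)
    fix x y z :: real
    assume "\<exists>k::int. y - x = 2 * pi * of_int k" "\<exists>k::int. z - y = 2 * pi * of_int k"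
    then obtain k l :: int where "y - x = 2 * pi * of_int k" "z - y = 2 * pi * of_int l" by blast
    then have "z - x = 2 * pi * of_int (k + l)" by (simp add: algebra_simps)
    then show "\<exists>k::int. z - x = 2 * pi * of_int k" by blast
  qed
qed

quotient_type angle = real / angle_rel
  morphisms rep_angle to_angle
  by (rule equivp_angle_rel)

instantiation angle :: ab_group_add
begin

lift_definition zero_angle :: angle is "0 :: real" .

lift_definition plus_angle :: "angle \<Rightarrow> angle \<Rightarrow> angle" is "(+) :: real \<Rightarrow> real \<Rightarrow> real"
proof -
  fix a b c d :: real assume "angle_rel a b" "angle_rel c d"
  then obtain k l :: int where "b - a = 2 * pi * of_int k" "d - c = 2 * pi * of_int l"
    unfolding angle_rel_def by blast
  then have "(b + d) - (a + c) = 2 * pi * of_int (k + l)" by (simp add: algebra_simps)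
  then show "angle_rel (a + c) (b + d)" unfolding angle_rel_def by blast
qed

lift_definition uminus_angle :: "angle \<Rightarrow> angle" is "uminus :: real \<Rightarrow> real"
proof -
  fix a b :: real assume "angle_rel a b"
  then obtain k :: int where "b - a = 2 * pi * of_int k"
    unfolding angle_rel_def by blast
  then have "(- b) - (- a) = 2 * pi * of_int (- k)" by (simp add: algebra_simps)
  then show "angle_rel (- a) (- b)" unfolding angle_rel_def by blast
qed

definition minus_angle :: "angle \<Rightarrow> angle \<Rightarrow> angle" where
  "minus_angle a b = a + - b"

instance
proof
  fix a b c :: angle
  show "a + b + c = a + (b + c)"
    by transfer (auto simp: add.assoc angle_rel_def intro: exI[of _ 0])
  show "a + b = b + a"
    by transfer (auto simp: add.commute angle_rel_def intro: exI[of _ 0])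
  show "0 + a = a"
    by transfer (auto simp: angle_rel_def intro: exI[of _ 0])
  show "- a + a = 0"
    by transfer (auto simp: angle_rel_def intro: exI[of _ 0])
  show "a - b = a + - b"
    by (rule minus_angle_def)
qed

end

instantiation angle :: topological_space
begin

definition open_angle :: "angle set \<Rightarrow> bool" where
  "open_angle U \<longleftrightarrow> open (to_angle -` U)"

instance
proof
  show "open (UNIV :: angle set)" by (simp add: open_angle_def)
  show "open (S \<inter> T)" if "open S" "open T" for S T :: "angle set"
    using that by (auto simp: open_angle_def vimage_Int)
  show "open (\<Union>K)" if "\<forall>S\<in>K. open S" for K :: "angle set set"
    using that by (auto simp: open_angle_def vimage_Union)
qed

end

lift_definition cis_angle :: "angle \<Rightarrow> complex" is cis
proof -
  fix a b :: real assume "angle_rel a b"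
  then obtain k :: int where "b = a + 2 * pi * of_int k"
    unfolding angle_rel_def by (metis add.commute diff_eq_eq)
  then have "cis b = cis a * cis (2 * pi * of_int k)" by (simp only: cis_mult)
  also have "cis (2 * pi * of_int k) = 1" by (rule cis_multiple_2pi) simp
  finally show "cis a = cis b" by simp
qed

text \<open>Used for \<open>z \<noteq> 0\<close> only.\<close>
definition arg :: "complex \<Rightarrow> angle" where
  "arg z = to_angle (Arg z)"

section \<open>The blow-up of \<open>\<complex>\<^sup>2\<close> at the origin\<close>

definition complex_line :: "complex \<times> complex \<Rightarrow> (complex \<times> complex) set" where
  "complex_line w = {(c * fst w, c * snd w) | c. True}"

definition blowup :: "((complex \<times> complex) \<times> (complex \<times> complex) set) set" where
  "blowup = {(p, L). p \<in> L \<and> (\<exists>w. w \<noteq> 0 \<and> L = complex_line w)}"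

definition exceptional_divisor :: "((complex \<times> complex) \<times> (complex \<times> complex) set) set" where
  "exceptional_divisor = {(p, L) \<in> blowup. p = 0}"

datatype chart_index = First | Second

text \<open>The point of the blow-up with coordinates \<open>(u\<^sub>j, v\<^sub>j)\<close>, where \<open>u\<^sub>1 = x\<close>, \<open>v\<^sub>1 = y/x\<close> and
  \<open>u\<^sub>2 = y\<close>, \<open>v\<^sub>2 = x/y\<close>.\<close>
fun blowup_pt ::
  "chart_index \<Rightarrow> complex \<times> complex \<Rightarrow> (complex \<times> complex) \<times> (complex \<times> complex) set" where
  "blowup_pt First (u, v) = ((u, u * v), complex_line (1, v))"
| "blowup_pt Second (u, v) = ((u * v, u), complex_line (v, 1))"

section \<open>The real oriented blow-up along the exceptional divisor\<close>

definition rob_local :: "(complex \<times> complex \<times> angle) set" where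
  "rob_local = closure {(u, v, \<theta>). u \<noteq> 0 \<and> u / of_real (cmod u) = cis_angle \<theta>}"

type_synonym local_pt = "chart_index \<times> complex \<times> complex \<times> angle"

definition rob_rel :: "(local_pt \<times> local_pt) set" where
  "rob_rel = {((j, u, v, \<theta>), (k, u', v', \<theta>')).
     (u, v, \<theta>) \<in> rob_local \<and> (u', v', \<theta>') \<in> rob_local \<and>
     blowup_pt j (u, v) = blowup_pt k (u', v') \<and>
     \<theta>' = (if j = k then \<theta> else \<theta> + arg v)}"

definition rob :: "local_pt set set" where
  "rob = (UNIV \<times> rob_local) // rob_rel"

definition rob_boundary :: "local_pt set set" where
  "rob_boundary = {p \<in> rob. \<exists>j u v \<theta>. (j, u, v, \<theta>) \<in> p \<and> blowup_pt j (u, v) \<in> exceptional_divisor}"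

text \<open>The point of the boundary with coordinates \<open>(v\<^sub>j, \<theta>\<^sub>j)\<close>.\<close>
definition boundary_pt :: "chart_index \<Rightarrow> complex \<Rightarrow> angle \<Rightarrow> local_pt set" where
  "boundary_pt j v \<theta> = rob_rel `` {(j, 0, v, \<theta>)}"

definition rob_coords :: "chart_index \<Rightarrow> local_pt set \<Rightarrow> complex \<times> complex \<times> angle" where
  "rob_coords j p = (THE q. (j, q) \<in> p)"

definition complex_coords :: "chart_index \<Rightarrow> local_pt set \<Rightarrow> real ^ 4" where
  "complex_coords j p = (case rob_coords j p of (u, v, \<theta>) \<Rightarrow> c2_coords (u, v))"

definition angle_branch :: "real \<Rightarrow> angle \<Rightarrow> real" where
  "angle_branch a \<theta> = (THE t. a < t \<and> t < a + 2 * pi \<and> to_angle t = \<theta>)"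

definition rob_chart_dom :: "chart_index \<Rightarrow> real \<Rightarrow> local_pt set set" where
  "rob_chart_dom j a =
     {p \<in> rob. \<exists>u v \<theta>. (j, u, v, \<theta>) \<in> p \<and> \<theta> \<in> to_angle ` {a<..<a + 2 * pi}}"

text \<open>On \<open>rob_local\<close> one has \<open>u = \<bar>u\<bar> e\<^sup>i\<^sup>\<theta>\<close>, so \<open>(\<bar>u\<bar>, \<theta>, v)\<close> are coordinates up to the boundary. The
  sign \<open>\<sigma>\<close> makes both orientations available.\<close>
definition rob_chart :: "chart_index \<Rightarrow> real \<Rightarrow> real \<Rightarrow> local_pt set \<Rightarrow> real ^ 4" where
  "rob_chart j a \<sigma> p = (case rob_coords j p of (u, v, \<theta>) \<Rightarrow>
     vector [- cmod u, \<sigma> * angle_branch a \<theta>, Re v, Im v])"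

text \<open>The charts which, off the boundary, are positively oriented with respect to the complex
  coordinates \<open>(u\<^sub>j, v\<^sub>j)\<close>.\<close>
definition rob_atlas :: "(local_pt set, 4) chart set" where
  "rob_atlas = {(rob_chart_dom j a, rob_chart j a \<sigma>) | j a \<sigma>. \<sigma> \<in> {1, -1} \<and>
     oriented_atlas (rob_chart_dom j a - rob_boundary)
       {(rob_chart_dom j a - rob_boundary, complex_coords j),
        (rob_chart_dom j a - rob_boundary, rob_chart j a \<sigma>)}}"

definition rob_boundary_atlas :: "(local_pt set, 3) chart set" where
  "rob_boundary_atlas = opposite_atlas (boundary_atlas rob_atlas)"

section \<open>The map and the circle actions\<close>

fun sphere_map :: "complex \<times> complex \<Rightarrow> local_pt set" where
  "sphere_map (z1, z2) =
     (if z1 \<noteq> 0 then boundary_pt First (z2 / z1) (arg z1)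
      else boundary_pt Second (z1 / z2) (arg z2))"

fun hopf_action :: "angle \<Rightarrow> complex \<times> complex \<Rightarrow> complex \<times> complex" where
  "hopf_action \<Theta> (z1, z2) = (cis_angle \<Theta> * z1, cis_angle \<Theta> * z2)"

text \<open>Acts on the representatives of a point; well defined on the boundary, see
  \<open>canonical_action_boundary_pt\<close> below.\<close>
definition canonical_action :: "angle \<Rightarrow> local_pt set \<Rightarrow> local_pt set" where
  "canonical_action \<Theta> p = (\<lambda>(j, u, v, \<theta>). (j, u, v, \<theta> + \<Theta>)) ` p"

section \<open>Consistency of the definitions\<close>

lemma exceptional_divisor_iff: "blowup_pt j (u, v) \<in> exceptional_divisor \<longleftrightarrow> u = 0"
proof (cases j)
  case First
  have "\<exists>w. w \<noteq> 0 \<and> complex_line (1, v) = complex_line w"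
    by (rule exI[of _ "(1, v)"]) (simp add: zero_prod_def)
  then show ?thesis unfolding First
    by (auto simp: exceptional_divisor_def blowup_def zero_prod_def complex_line_def)
next
  case Second
  have "\<exists>w. w \<noteq> 0 \<and> complex_line (v, 1) = complex_line w"
    by (rule exI[of _ "(v, 1)"]) (simp add: zero_prod_def)
  then show ?thesis unfolding Second
    by (auto simp: exceptional_divisor_def blowup_def zero_prod_def complex_line_def)
qed

lemma complex_line_eq:
  "complex_line (1, v) = complex_line (1, v') \<longleftrightarrow> v = v'"
  "complex_line (v, 1) = complex_line (v', 1) \<longleftrightarrow> v = v'"
  "complex_line (1, v) = complex_line (v', 1) \<longleftrightarrow> v * v' = 1"
proof -
  have 1: "(a, b) \<in> complex_line (1, v) \<longleftrightarrow> b = a * v" for a b v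
    by (auto simp: complex_line_def)
  have 2: "(a, b) \<in> complex_line (v, 1) \<longleftrightarrow> a = b * v" for a b v
    by (auto simp: complex_line_def)
  show "complex_line (1, v) = complex_line (1, v') \<longleftrightarrow> v = v'"
    by (metis 1 mult_1)
  show "complex_line (v, 1) = complex_line (v', 1) \<longleftrightarrow> v = v'"
    by (metis 2 mult_1)
  show "complex_line (1, v) = complex_line (v', 1) \<longleftrightarrow> v * v' = 1"
  proof
    assume "complex_line (1, v) = complex_line (v', 1)"
    then have "(1, v) \<in> complex_line (v', 1)" by (metis 1 mult_1)
    then show "v * v' = 1" by (simp add: 2)
  next
    assume *: "v * v' = 1"
    have "b = a * v \<longleftrightarrow> a = b * v'" for a b
      using * by (metis mult.assoc mult.commute mult.right_neutral)
    then show "complex_line (1, v) = complex_line (v', 1)"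
      by (auto simp: set_eq_iff 1 2)
  qed
qed

lemma blowup_pt_eq:
  "blowup_pt j (u, v) = blowup_pt j (u', v') \<longleftrightarrow> u = u' \<and> v = v'"
  "j \<noteq> k \<Longrightarrow> blowup_pt j (u, v) = blowup_pt k (u', v') \<longleftrightarrow> v \<noteq> 0 \<and> u' = u * v \<and> v' = 1 / v"
proof -
  show "blowup_pt j (u, v) = blowup_pt j (u', v') \<longleftrightarrow> u = u' \<and> v = v'"
    by (cases j) (auto simp: complex_line_eq)
  show "blowup_pt j (u, v) = blowup_pt k (u', v') \<longleftrightarrow> v \<noteq> 0 \<and> u' = u * v \<and> v' = 1 / v"
    if "j \<noteq> k"
  proof (cases j)
    case First
    with that have k: "k = Second" by (cases k) auto
    show ?thesis unfolding First k
      by (cases "v = 0") (auto simp: complex_line_eq eq_divide_eq mult.commute)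
  next
    case Second
    with that have k: "k = First" by (cases k) auto
    have "complex_line (v, 1) = complex_line (1, v') \<longleftrightarrow> v' * v = 1"
      using complex_line_eq(3)[of v' v] by auto
    then show ?thesis unfolding Second k
      by (cases "v = 0") (auto simp: eq_divide_eq mult.commute)
  qed
qed

lemma blowup_eq: "blowup = range (blowup_pt First) \<union> range (blowup_pt Second)"
proof (rule subset_antisym)
  show "range (blowup_pt First) \<union> range (blowup_pt Second) \<subseteq> blowup"
  proof -
    have "(1 :: complex, v) \<noteq> 0" "(v, 1 :: complex) \<noteq> 0" for v :: complex
      unfolding zero_prod_def by simp_all
    moreover have "(u, u * v) \<in> complex_line (1, v)" "(u * v, u) \<in> complex_line (v, 1)" for u v
      by (auto simp: complex_line_def)
    ultimately have "blowup_pt First (u, v) \<in> blowup" "blowup_pt Second (u, v) \<in> blowup" for u v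
      unfolding blowup_def by (simp_all, blast+)
    then show ?thesis by auto
  qed
  show "blowup \<subseteq> range (blowup_pt First) \<union> range (blowup_pt Second)"
  proof
    fix q assume "q \<in> blowup"
    then obtain x y a b where q: "q = ((x, y), complex_line (a, b))"
      and xy: "(x, y) \<in> complex_line (a, b)" and ab: "a \<noteq> 0 \<or> b \<noteq> 0"
      by (auto simp: blowup_def zero_prod_def)
    have scale: "complex_line (a, b) = complex_line (c * a, c * b)" if "c \<noteq> 0" for c
    proof (rule subset_antisym)
      have "(d * a, d * b) \<in> complex_line (c * a, c * b)" for d
        unfolding complex_line_def using that by (auto intro!: exI[of _ "d / c"])
      then show "complex_line (a, b) \<subseteq> complex_line (c * a, c * b)"
        by (auto simp: complex_line_def)
      have "(d * (c * a), d * (c * b)) \<in> complex_line (a, b)" for d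
        unfolding complex_line_def by (auto intro!: exI[of _ "d * c"])
      then show "complex_line (c * a, c * b) \<subseteq> complex_line (a, b)"
        by (auto simp: complex_line_def)
    qed
    show "q \<in> range (blowup_pt First) \<union> range (blowup_pt Second)"
    proof (cases "a = 0")
      case False
      have L: "complex_line (a, b) = complex_line (1, b / a)"
        using scale[of "1 / a"] False by simp
      with xy have "y = x * (b / a)" by (auto simp: complex_line_def)
      then have "q = blowup_pt First (x, b / a)" by (simp add: q L)
      then show ?thesis by blast
    next
      case True
      with ab have "b \<noteq> 0" by simp
      then have L: "complex_line (a, b) = complex_line (a / b, 1)"
        using scale[of "1 / b"] by simp
      with xy have "x = y * (a / b)" by (auto simp: complex_line_def)
      then have "q = blowup_pt Second (y, a / b)" by (simp add: q L)
      then show ?thesis by blast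
    qed
  qed
qed

lemma to_angle_eq_iff: "to_angle x = to_angle y \<longleftrightarrow> (\<exists>k::int. y - x = 2 * pi * of_int k)"
  by (simp add: angle.abs_eq_iff angle_rel_def)

lemma cis_angle_to_angle: "cis_angle (to_angle t) = cis t"
  by (rule cis_angle.abs_eq)

lemma continuous_to_angle: "continuous_on UNIV to_angle"
  by (simp add: continuous_on_open_vimage open_angle_def)

lemma continuous_cis_angle: "continuous_on UNIV cis_angle"
  unfolding continuous_on_open_vimage[OF open_UNIV]
proof (intro allI impI)
  fix B :: "complex set" assume "open B"
  moreover have "continuous_on UNIV cis" by (intro continuous_intros)
  ultimately have "open (cis -` B)"
    by (simp add: continuous_on_open_vimage)
  moreover have "to_angle -` (cis_angle -` B) = cis -` B"
    by (auto simp: cis_angle_to_angle)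
  ultimately show "open (cis_angle -` B \<inter> UNIV)" by (simp add: open_angle_def)
qed

lemma norm_cis_angle: "cmod (cis_angle \<theta>) = 1"
  by transfer simp

lemma cis_angle_add: "cis_angle (a + b) = cis_angle a * cis_angle b"
  by transfer (simp add: cis_mult)

lemma rob_local_iff: "(u, v, \<theta>) \<in> rob_local \<longleftrightarrow> u = of_real (cmod u) * cis_angle \<theta>"
proof
  let ?S = "{(u, v, \<theta>). u \<noteq> 0 \<and> u / of_real (cmod u) = cis_angle \<theta>}"
    and ?T = "{q :: complex \<times> complex \<times> angle.
                fst q = of_real (cmod (fst q)) * cis_angle (snd (snd q))}"
  have c: "continuous_on UNIV (\<lambda>q :: complex \<times> complex \<times> angle. cis_angle (snd (snd q)))"
    by (rule continuous_on_compose2[OF continuous_cis_angle]) (auto intro!: continuous_intros)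
  have "closed ?T"
    by (intro closed_Collect_eq continuous_intros c)
  moreover have "?S \<subseteq> ?T"
  proof clarsimp
    fix u :: complex and \<theta> assume "u \<noteq> 0" "u / of_real (cmod u) = cis_angle \<theta>"
    then show "u = of_real (cmod u) * cis_angle \<theta>"
      by (metis norm_eq_zero nonzero_mult_div_cancel_left of_real_eq_0_iff times_divide_eq_right)
  qed
  ultimately have "rob_local \<subseteq> ?T"
    unfolding rob_local_def by (rule closure_minimal[rotated])
  then show "u = of_real (cmod u) * cis_angle \<theta>" if "(u, v, \<theta>) \<in> rob_local"
    using that by auto
  show "(u, v, \<theta>) \<in> rob_local" if *: "u = of_real (cmod u) * cis_angle \<theta>"
  proof (cases "u = 0")
    case False
    then have "u / of_real (cmod u) = cis_angle \<theta>"
      by (subst *) (use False in simp)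
    with False have "(u, v, \<theta>) \<in> ?S" by simp
    then show ?thesis unfolding rob_local_def by (rule subsetD[OF closure_subset])
  next
    case True
    show ?thesis unfolding rob_local_def closure_iff_nhds_not_empty
    proof (intro allI impI)
      fix A V :: "(complex \<times> complex \<times> angle) set"
      assume "V \<subseteq> A" "open V" "(u, v, \<theta>) \<in> V"
      let ?g = "\<lambda>r::real. (of_real r * cis_angle \<theta>, v, \<theta>)"
      have "continuous_on UNIV ?g"
        by (intro continuous_on_Pair continuous_on_mult continuous_on_of_real_id continuous_on_const)
      then have "open (?g -` V)"
        using \<open>open V\<close> by (metis continuous_on_open_vimage open_UNIV inf_top.right_neutral)
      moreover have "0 \<in> ?g -` V" using \<open>(u, v, \<theta>) \<in> V\<close> True by simp
      ultimately obtain e where e: "e > 0" "ball 0 e \<subseteq> ?g -` V"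
        by (meson openE)
      moreover have "e / 2 \<in> ball 0 e" using \<open>e > 0\<close> by simp
      ultimately have "e / 2 \<in> ?g -` V" by blast
      moreover have "?g (e / 2) \<in> ?S"
      proof -
        have "cis_angle \<theta> \<noteq> 0" using norm_cis_angle[of \<theta>] by force
        moreover have "cmod (of_real (e / 2) * cis_angle \<theta>) = e / 2"
          using \<open>e > 0\<close> by (simp add: norm_mult norm_cis_angle)
        ultimately show ?thesis using \<open>e > 0\<close> by simp
      qed
      ultimately show "?S \<inter> A \<noteq> {}" using \<open>V \<subseteq> A\<close> by blast
    qed
  qed
qed

lemma rob_local_boundary: "(0, v, \<theta>) \<in> rob_local"
  by (simp add: rob_local_iff)

lemma cis_angle_arg: "z \<noteq> 0 \<Longrightarrow> of_real (cmod z) * cis_angle (arg z) = z"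
  by (simp add: arg_def cis_angle_to_angle cis_Arg sgn_eq)

lemma cis_angle_inj: "cis_angle a = cis_angle b \<longleftrightarrow> a = b"
proof
  assume "cis_angle a = cis_angle b"
  then show "a = b"
  proof transfer
    fix x y :: real assume "cis x = cis y"
    then have "sin y = sin x \<and> cos y = cos x" by (simp add: complex_eq_iff)
    then obtain n :: int where "y = x + 2 * pi * n" by (auto simp: sin_cos_eq_iff)
    then show "angle_rel x y" by (auto simp: angle_rel_def)
  qed
qed simp

lemma arg_mult: "z \<noteq> 0 \<Longrightarrow> w \<noteq> 0 \<Longrightarrow> arg (z * w) = arg z + arg w"
proof -
  assume *: "z \<noteq> 0" "w \<noteq> 0"
  have "of_real (cmod z * cmod w) * cis_angle (arg (z * w)) = z * w"
    using cis_angle_arg[of "z * w"] * by (simp add: norm_mult)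
  also have "\<dots> = (of_real (cmod z) * cis_angle (arg z)) * (of_real (cmod w) * cis_angle (arg w))"
    by (simp only: cis_angle_arg[OF *(1)] cis_angle_arg[OF *(2)])
  finally have "cis_angle (arg (z * w)) = cis_angle (arg z + arg w)"
    using * by (simp add: cis_angle_add)
  then show ?thesis by (simp add: cis_angle_inj)
qed

lemma equiv_rob_rel: "equiv (UNIV \<times> rob_local) rob_rel"
proof (rule equivI)
  have arg_inv: "arg v + arg v' = 0" if "v * v' = 1" for v v'
  proof -
    have "arg (v * v') = arg v + arg v'" using that by (intro arg_mult) auto
    moreover have "arg 1 = 0" by (simp add: arg_def zero_angle.abs_eq)
    ultimately show ?thesis using that by simp
  qed
  show "rob_rel \<subseteq> (UNIV \<times> rob_local) \<times> (UNIV \<times> rob_local)"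
    by (auto simp: rob_rel_def)
  show "refl_on (UNIV \<times> rob_local) rob_rel"
    by (auto simp: refl_on_def rob_rel_def)
  show "sym rob_rel"
  proof (rule symI)
    fix p q assume pq: "(p, q) \<in> rob_rel"
    obtain j u v \<theta> k u' v' \<theta>' where [simp]: "p = (j, u, v, \<theta>)" "q = (k, u', v', \<theta>')"
      by (metis prod.exhaust)
    show "(q, p) \<in> rob_rel"
    proof (cases "j = k")
      case True
      with pq show ?thesis by (auto simp: rob_rel_def)
    next
      case False
      with pq have "v * v' = 1" "\<theta>' = \<theta> + arg v"
        by (auto simp: rob_rel_def blowup_pt_eq(2)[OF False])
      with arg_inv have "\<theta> = \<theta>' + arg v'" by (simp add: add.assoc)
      with pq False show ?thesis by (auto simp: rob_rel_def)
    qed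
  qed
  show "trans rob_rel"
  proof (rule transI)
    fix p q r assume pq: "(p, q) \<in> rob_rel" and qr: "(q, r) \<in> rob_rel"
    obtain j u v \<theta> k u' v' \<theta>' l u'' v'' \<theta>''
      where [simp]: "p = (j, u, v, \<theta>)" "q = (k, u', v', \<theta>')" "r = (l, u'', v'', \<theta>'')"
      by (metis prod.exhaust)
    have eq: "blowup_pt j (u, v) = blowup_pt l (u'', v'')"
      using pq qr by (simp add: rob_rel_def)
    have t: "\<theta>' = (if j = k then \<theta> else \<theta> + arg v)"
            "\<theta>'' = (if k = l then \<theta>' else \<theta>' + arg v')"
      using pq qr by (simp_all add: rob_rel_def)
    have "\<theta>'' = (if j = l then \<theta> else \<theta> + arg v)"
    proof (cases "j = k")
      case True
      then have "v' = v" using pq by (simp add: rob_rel_def blowup_pt_eq(1))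
      with True t show ?thesis by auto
    next
      case jk: False
      show ?thesis
      proof (cases "k = l")
        case True
        with jk t show ?thesis by auto
      next
        case False
        with jk have "j = l" by (metis chart_index.exhaust)
        moreover have "v * v' = 1"
          using pq jk by (auto simp: rob_rel_def blowup_pt_eq(2)[OF jk])
        ultimately show ?thesis using jk False t arg_inv by (simp add: add.assoc)
      qed
    qed
    moreover have "(u, v, \<theta>) \<in> rob_local"
      using pq by (auto simp: rob_rel_def)
    moreover have "(u'', v'', \<theta>'') \<in> rob_local"
      using qr by (auto simp: rob_rel_def)
    ultimately show "(p, r) \<in> rob_rel"
      unfolding rob_rel_def using eq by simp
  qed
qed

lemma boundary_pt_eq:
  "boundary_pt j v \<theta> = boundary_pt k v' \<theta>' \<longleftrightarrow>
     (if j = k then v' = v \<and> \<theta>' = \<theta> else v \<noteq> 0 \<and> v' = 1 / v \<and> \<theta>' = \<theta> + arg v)"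
proof -
  have "boundary_pt j v \<theta> = boundary_pt k v' \<theta>' \<longleftrightarrow> ((j, 0, v, \<theta>), (k, 0, v', \<theta>')) \<in> rob_rel"
    unfolding boundary_pt_def
    by (rule eq_equiv_class_iff[OF equiv_rob_rel]) (simp_all add: rob_local_boundary)
  also have "\<dots> \<longleftrightarrow>
     (if j = k then v' = v \<and> \<theta>' = \<theta> else v \<noteq> 0 \<and> v' = 1 / v \<and> \<theta>' = \<theta> + arg v)"
    by (auto simp: rob_rel_def rob_local_boundary blowup_pt_eq)
  finally show ?thesis .
qed

lemma rob_boundary_eq: "rob_boundary = {boundary_pt j v \<theta> | j v \<theta>. True}"
proof (intro set_eqI iffI)
  fix p assume "p \<in> rob_boundary"
  then obtain j u v \<theta> where p: "p \<in> rob" "(j, u, v, \<theta>) \<in> p" "u = 0"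
    by (auto simp: rob_boundary_def exceptional_divisor_iff)
  then obtain q where q: "p = rob_rel `` {q}"
    unfolding rob_def by (auto elim: quotientE)
  with p have "(q, (j, u, v, \<theta>)) \<in> rob_rel" by simp
  then have "p = rob_rel `` {(j, u, v, \<theta>)}"
    unfolding q by (rule equiv_class_eq[OF equiv_rob_rel])
  then show "p \<in> {boundary_pt j v \<theta> | j v \<theta>. True}"
    using p by (auto simp: boundary_pt_def)
next
  fix p assume "p \<in> {boundary_pt j v \<theta> | j v \<theta>. True}"
  then obtain j v \<theta> where p: "p = boundary_pt j v \<theta>" by blast
  have "p \<in> rob"
    unfolding p rob_def boundary_pt_def by (rule quotientI) (simp add: rob_local_boundary)
  moreover have "(j, 0, v, \<theta>) \<in> p"
    unfolding p boundary_pt_def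
    by (rule equiv_class_self[OF equiv_rob_rel]) (simp add: rob_local_boundary)
  moreover have "blowup_pt j (0, v) \<in> exceptional_divisor"
    by (simp add: exceptional_divisor_iff)
  ultimately show "p \<in> rob_boundary" unfolding rob_boundary_def by blast
qed

lemma canonical_action_boundary_pt:
  "canonical_action \<Theta> (boundary_pt j v \<theta>) = boundary_pt j v (\<theta> + \<Theta>)"
proof -
  have mem: "(k, u', v', \<theta>') \<in> boundary_pt j v \<theta> \<longleftrightarrow> u' = 0 \<and>
      (if j = k then v' = v \<and> \<theta>' = \<theta> else v \<noteq> 0 \<and> v' = 1 / v \<and> \<theta>' = \<theta> + arg v)"
    for k u' v' \<theta>' \<theta>
    by (auto simp: boundary_pt_def rob_rel_def rob_local_boundary blowup_pt_eq)
  show ?thesis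
  proof (intro set_eqI iffI)
    fix q assume "q \<in> canonical_action \<Theta> (boundary_pt j v \<theta>)"
    then show "q \<in> boundary_pt j v (\<theta> + \<Theta>)"
      by (auto simp: canonical_action_def mem ac_simps split: if_splits)
  next
    fix q assume q: "q \<in> boundary_pt j v (\<theta> + \<Theta>)"
    obtain k u' v' \<theta>' where [simp]: "q = (k, u', v', \<theta>')" by (metis prod.exhaust)
    from q have "(k, u', v', \<theta>' - \<Theta>) \<in> boundary_pt j v \<theta>"
      by (auto simp: mem algebra_simps split: if_splits)
    then show "q \<in> canonical_action \<Theta> (boundary_pt j v \<theta>)"
      unfolding canonical_action_def by (rule rev_image_eqI) simp
  qed
qed

lemma S3_eq_sphere: "S3 = sphere 0 1"
  by (auto simp: S3_def norm_prod_def)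

end

(* In the chart (v_j, theta_j) of the boundary, the map reads off v_j = z_k/z_j and theta_j = arg z_j.
   Completed by ln |z|, the same functions are a chart of C^2 that straightens the unit ball; it is
   positively oriented because its inverse (ln |z|, theta, v) -> (z_j, z_j v) has Jacobian |z_j|^4.
   In such charts the map is therefore the identity, and everything about the boundary of the blow-up
   is transported from the sphere. The signs match since u = r exp(i theta) makes (-r, -theta, v)
   positive: outward normal first gives (-theta, v) on the boundary, and the opposite orientation
   is (theta, v). *)
theory Submission
  imports Defs
begin

subsection \<open>Calculus of smooth maps\<close>

text \<open>The obstacle is that \<open>S3_atlas\<close> is not a list of formulas: it contains the
  boundary restriction of every oriented chart of C^2 that straightens the ball. Such charts are
  known only through their comparison with \<open>c2_coords\<close>, so it has to be proved in
  general that a transition with positive Jacobian in dimension four restricts to one with positive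
  Jacobian in dimension three (\<open>compatible_boundary_chart\<close>). On the other side,
  \<open>rob_atlas\<close> is given by a condition on the sign \<open>\<sigma>\<close>, which must
  be shown to hold for \<open>- 1\<close> and also to fail for \<open>1\<close>; otherwise the atlas
  would contain charts of both orientations. The transport asks only that every chart of the target
  pull back to some member of \<open>S3_atlas\<close>, and the Hopf charts supply these
  members.\<close>

lemma Ck_on_cong:
  assumes "open S" "\<And>x. x \<in> S \<Longrightarrow> f x = g x" "Ck_on k f S"
  shows "Ck_on k g S"
  using assms(2,3)
proof (induction k arbitrary: f g)
  case 0
  then show ?case by (simp cong: continuous_on_cong)
next
  case (Suc k)
  \<comment> \<open>On an open set, equality of functions passes to their derivatives, which is what
    the induction on the order needs.\<close>
  have d: "(g has_derivative frechet_derivative f (at x)) (at x)" if "x \<in> S" for x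
    by (rule has_derivative_transform_within_open[OF frechet_derivative_works[THEN iffD1] assms(1) that])
      (use Suc.prems that in simp_all)
  then have "frechet_derivative g (at x) = frechet_derivative f (at x)" if "x \<in> S" for x
    using that by (metis frechet_derivative_at)
  then have "Ck_on k (\<lambda>x. frechet_derivative g (at x) v) S" for v
    using Suc.prems(2) by (simp add: Suc.IH[of "\<lambda>x. frechet_derivative f (at x) v"])
  then show ?case using d by (auto simp: differentiable_def)
qed

text \<open>Lets any explicitly known derivative stand in for \<open>frechet_derivative\<close>, so
  that the inductions below can use the usual differentiation rules.\<close>

lemma Ck_on_SucI:
  assumes "open S" "\<And>x. x \<in> S \<Longrightarrow> (f has_derivative f' x) (at x)"
    and "\<And>v. Ck_on k (\<lambda>x. f' x v) S"
  shows "Ck_on (Suc k) f S"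
proof -
  have "f' x = frechet_derivative f (at x)" if "x \<in> S" for x
    using assms(2)[OF that] by (rule frechet_derivative_at)
  then have "Ck_on k (\<lambda>x. frechet_derivative f (at x) v) S" for v
    by (intro Ck_on_cong[OF assms(1) _ assms(3)]) simp
  then show ?thesis using assms(2) by (auto simp: differentiable_def)
qed

lemma Ck_on_SucD:
  assumes "Ck_on (Suc k) f S"
  shows "\<And>x. x \<in> S \<Longrightarrow> (f has_derivative frechet_derivative f (at x)) (at x)"
    and "\<And>v. Ck_on k (\<lambda>x. frechet_derivative f (at x) v) S"
  using assms by (auto simp: frechet_derivative_works)

lemma Ck_on_Suc_imp: "Ck_on (Suc k) f S \<Longrightarrow> Ck_on k f S"
proof (induction k arbitrary: f)
  case 0
  then show ?case
    by (auto intro!: continuous_at_imp_continuous_on differentiable_imp_continuous_within)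
next
  case (Suc k)
  then show ?case by (metis Ck_on.simps(2))
qed

lemma Ck_on_imp_continuous_on: "Ck_on k f S \<Longrightarrow> continuous_on S f"
  by (induction k) (auto dest: Ck_on_Suc_imp simp del: Ck_on.simps(2))

lemma Ck_on_subset: "Ck_on k f S \<Longrightarrow> T \<subseteq> S \<Longrightarrow> Ck_on k f T"
  by (induction k arbitrary: f) (auto intro: continuous_on_subset)

lemma Ck_on_const: "Ck_on k (\<lambda>x. c) S"
  by (induction k arbitrary: c) (auto intro: continuous_intros)

lemma Ck_on_bounded_linear:
  assumes "open S" "bounded_linear L" "Ck_on k f S"
  shows "Ck_on k (\<lambda>x. L (f x)) S"
  using assms(3)
proof (induction k arbitrary: f)
  case 0
  then show ?case using assms(2) by (auto intro: bounded_linear.continuous_on)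
next
  case (Suc k)
  show ?case
    by (rule Ck_on_SucI[OF assms(1)],
        rule bounded_linear.has_derivative[OF assms(2) Ck_on_SucD(1)[OF Suc.prems]], assumption)
      (rule Suc.IH[OF Ck_on_SucD(2)[OF Suc.prems]])
qed

lemma Ck_on_linear: "open S \<Longrightarrow> bounded_linear f \<Longrightarrow> Ck_on k f S"
proof (induction k)
  case 0
  then show ?case by (simp add: linear_continuous_on)
next
  case (Suc k)
  show ?case
    by (rule Ck_on_SucI[OF Suc.prems(1)], rule bounded_linear_imp_has_derivative[OF Suc.prems(2)])
      (rule Ck_on_const)
qed

lemma Ck_on_add:
  assumes "open S" "Ck_on k f S" "Ck_on k g S"
  shows "Ck_on k (\<lambda>x. f x + g x) S"
  using assms(2,3)
proof (induction k arbitrary: f g)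
  case 0
  then show ?case by (auto intro: continuous_intros)
next
  case (Suc k)
  show ?case
    by (rule Ck_on_SucI[OF assms(1)],
        rule has_derivative_add[OF Ck_on_SucD(1)[OF Suc.prems(1)] Ck_on_SucD(1)[OF Suc.prems(2)]],
        assumption, assumption)
      (rule Suc.IH[OF Ck_on_SucD(2)[OF Suc.prems(1)] Ck_on_SucD(2)[OF Suc.prems(2)]])
qed

lemma Ck_on_sum:
  assumes "open S" "finite I" "\<And>i. i \<in> I \<Longrightarrow> Ck_on k (f i) S"
  shows "Ck_on k (\<lambda>x. \<Sum>i\<in>I. f i x) S"
  using assms(2,3) by (induction I rule: finite_induct) (auto intro: Ck_on_add Ck_on_const assms(1))

lemma Ck_on_bilinear:
  assumes "bounded_bilinear B" "open S" "Ck_on k f S" "Ck_on k g S"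
  shows "Ck_on k (\<lambda>x. B (f x) (g x)) S"
  using assms(3,4)
proof (induction k arbitrary: f g)
  case 0
  then show ?case using assms(1) by (auto intro: bounded_bilinear.continuous_on)
next
  case (Suc k)
  show ?case
    by (rule Ck_on_SucI[OF assms(2)],
        rule bounded_bilinear.FDERIV[OF assms(1) Ck_on_SucD(1)[OF Suc.prems(1)]
          Ck_on_SucD(1)[OF Suc.prems(2)]],
        assumption, assumption)
      (intro Ck_on_add assms(2) Suc.IH Ck_on_Suc_imp[OF Suc.prems(1)] Ck_on_Suc_imp[OF Suc.prems(2)]
        Ck_on_SucD(2)[OF Suc.prems(1)] Ck_on_SucD(2)[OF Suc.prems(2)])
qed

text \<open>Induction over all \<open>g\<close> with \<open>f\<close> fixed: the partial derivatives
  of \<open>g\<close> are again composed with \<open>f\<close>.\<close>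

lemma Ck_on_compose:
  fixes f :: "'a::euclidean_space \<Rightarrow> 'b::euclidean_space"
  assumes "open S" "open T" "f ` S \<subseteq> T" "Ck_on k f S" "Ck_on k g T"
  shows "Ck_on k (\<lambda>x. g (f x)) S"
  using assms(4,5)
proof (induction k arbitrary: g)
  case 0
  then show ?case using assms(3) by (auto intro: continuous_on_compose2)
next
  case (Suc k)
  show ?case
  proof (rule Ck_on_SucI[OF assms(1)])
    show "((\<lambda>x. g (f x)) has_derivative
      (\<lambda>v. frechet_derivative g (at (f x)) (frechet_derivative f (at x) v))) (at x)" if "x \<in> S" for x
      using that assms(3)
      by (intro has_derivative_compose[OF Ck_on_SucD(1)[OF Suc.prems(1)] Ck_on_SucD(1)[OF Suc.prems(2)]])
        auto
    fix v
    \<comment> \<open>The direction in which \<open>g\<close> is differentiated depends on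
      \<open>x\<close>, so the induction hypothesis does not apply directly. Expanding it in the
      basis leaves fixed directions \<open>b\<close> with scalar coefficients.\<close>
    have "frechet_derivative g (at (f x)) (frechet_derivative f (at x) v) =
        (\<Sum>b\<in>Basis. (frechet_derivative f (at x) v \<bullet> b) *\<^sub>R frechet_derivative g (at (f x)) b)"
      if "x \<in> S" for x
    proof -
      have "linear (frechet_derivative g (at (f x)))"
        using Ck_on_SucD(1)[OF Suc.prems(2)] that assms(3)
        by (intro has_derivative_linear) auto
      then show ?thesis
        by (subst euclidean_representation[of "frechet_derivative f (at x) v", symmetric])
          (simp add: linear_sum linear_scale)
    qed
    moreover have *: "Ck_on k (\<lambda>x. frechet_derivative f (at x) v) S"
      "Ck_on k (\<lambda>x. frechet_derivative g (at (f x)) b) S" for b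
      using Ck_on_SucD(2)[OF Suc.prems(1)]
        Suc.IH[OF Ck_on_Suc_imp[OF Suc.prems(1)] Ck_on_SucD(2)[OF Suc.prems(2)]] by simp_all
    moreover have "Ck_on k (\<lambda>x. \<Sum>b\<in>Basis. (frechet_derivative f (at x) v \<bullet> b) *\<^sub>R
        frechet_derivative g (at (f x)) b) S"
      by (intro Ck_on_sum assms(1) finite_Basis Ck_on_bilinear[OF bounded_bilinear_scaleR] *
          Ck_on_bounded_linear[OF _ bounded_linear_inner_left])
    ultimately show "Ck_on k
        (\<lambda>x. frechet_derivative g (at (f x)) (frechet_derivative f (at x) v)) S"
      using Ck_on_cong[OF assms(1)] by (metis (mono_tags, lifting))
  qed
qed

text \<open>The real derivative in direction \<open>v\<close> is \<open>f' z * v\<close>, so its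
  regularity is that of the complex derivative.\<close>

lemma Ck_on_holomorphic:
  fixes f :: "complex \<Rightarrow> complex"
  assumes "open S" "\<And>z. z \<in> S \<Longrightarrow> (f has_field_derivative f' z) (at z)" "Ck_on k f' S"
  shows "Ck_on (Suc k) f S"
  by (rule Ck_on_SucI[OF assms(1) assms(2)[unfolded has_field_derivative_def]], assumption)
    (intro Ck_on_bilinear[OF bounded_bilinear_mult] assms Ck_on_const)

text \<open>Bootstrapping: the derivative is a polynomial in \<open>inverse\<close> itself.\<close>

lemma Ck_on_inverse: "Ck_on k (inverse :: complex \<Rightarrow> complex) (- {0})"
proof (induction k)
  case 0
  then show ?case by (auto intro!: continuous_intros)
next
  case (Suc k)
  have "Ck_on k (\<lambda>z. - 1 * (inverse z * inverse z) :: complex) (- {0})"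
    by (intro Ck_on_bilinear[OF bounded_bilinear_mult] Ck_on_const Suc) auto
  moreover have "(inverse has_field_derivative - 1 * (inverse z * inverse z)) (at z)"
    if "z \<in> - {0}" for z :: complex
    using DERIV_inverse[of z UNIV] that by (simp add: numeral_2_eq_2)
  ultimately show ?case by (intro Ck_on_holomorphic) auto
qed

lemma Ck_on_Ln: "Ck_on k Ln (- \<real>\<^sub>\<le>\<^sub>0)"
proof (cases k)
  case 0
  then show ?thesis by (auto intro!: continuous_intros)
next
  case (Suc m)
  have "Ck_on m (inverse :: complex \<Rightarrow> complex) (- \<real>\<^sub>\<le>\<^sub>0)"
    by (rule Ck_on_subset[OF Ck_on_inverse]) auto
  then show ?thesis unfolding Suc
    by (intro Ck_on_holomorphic) (auto intro: has_field_derivative_Ln simp: open_Compl)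
qed

lemma Ck_on_exp: "Ck_on k (exp :: complex \<Rightarrow> complex) UNIV"
  by (induction k) (auto intro!: Ck_on_holomorphic DERIV_exp continuous_intros simp del: Ck_on.simps(2))

lemma Ck_on_vec:
  fixes f :: "'a::euclidean_space \<Rightarrow> real ^ 'n"
  assumes "open S" "\<And>i. Ck_on k (\<lambda>x. f x $ i) S"
  shows "Ck_on k f S"
proof -
  have "Ck_on k (\<lambda>x. \<Sum>i\<in>UNIV. (f x $ i) *\<^sub>R axis i (1::real)) S"
    by (intro Ck_on_sum assms Ck_on_bilinear[OF bounded_bilinear_scaleR] Ck_on_const) auto
  then show ?thesis
    by (rule Ck_on_cong[OF assms(1), rotated])
      (simp add: basis_expansion scalar_mult_eq_scaleR[symmetric])
qed

section \<open>Closure properties of smooth maps\<close>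

lemma smooth_on_cong: "open S \<Longrightarrow> (\<And>x. x \<in> S \<Longrightarrow> f x = g x) \<Longrightarrow> smooth_on f S \<Longrightarrow> smooth_on g S"
  unfolding smooth_on_def using Ck_on_cong by blast

lemma smooth_on_subset: "smooth_on f S \<Longrightarrow> T \<subseteq> S \<Longrightarrow> smooth_on f T"
  unfolding smooth_on_def using Ck_on_subset by blast

lemma smooth_on_compose:
  fixes f :: "'a::euclidean_space \<Rightarrow> 'b::euclidean_space"
  assumes "open S" "open T" "f ` S \<subseteq> T" "smooth_on f S" "smooth_on g T"
  shows "smooth_on (\<lambda>x. g (f x)) S"
  using assms unfolding smooth_on_def by (simp add: Ck_on_compose[where f = f and g = g and T = T])

lemma smooth_on_imp_continuous_on: "smooth_on f S \<Longrightarrow> continuous_on S f"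
  unfolding smooth_on_def using Ck_on_imp_continuous_on by blast

lemma smooth_on_has_derivative:
  "smooth_on f S \<Longrightarrow> x \<in> S \<Longrightarrow> (f has_derivative frechet_derivative f (at x)) (at x)"
  unfolding smooth_on_def using Ck_on_SucD(1) by blast

lemma smooth_on_bounded_linear: "open S \<Longrightarrow> bounded_linear L \<Longrightarrow> smooth_on f S \<Longrightarrow> smooth_on (\<lambda>x. L (f x)) S"
  unfolding smooth_on_def by (simp add: Ck_on_bounded_linear[where L = L and f = f])

lemma smooth_on_linear: "open S \<Longrightarrow> bounded_linear f \<Longrightarrow> smooth_on f S"
  unfolding smooth_on_def by (simp add: Ck_on_linear)

lemma smooth_on_const: "smooth_on (\<lambda>x. c) S"
  unfolding smooth_on_def by (simp add: Ck_on_const)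

lemma smooth_on_add:
  "open S \<Longrightarrow> smooth_on f S \<Longrightarrow> smooth_on g S \<Longrightarrow> smooth_on (\<lambda>x. f x + g x) S"
  unfolding smooth_on_def by (simp add: Ck_on_add)

lemma smooth_on_bilinear:
  "bounded_bilinear B \<Longrightarrow> open S \<Longrightarrow> smooth_on f S \<Longrightarrow> smooth_on g S \<Longrightarrow>
    smooth_on (\<lambda>x. B (f x) (g x)) S"
  unfolding smooth_on_def by (simp add: Ck_on_bilinear[where B = B and f = f and g = g])

lemmas smooth_on_mult = smooth_on_bilinear[OF bounded_bilinear_mult]

lemma smooth_on_vec:
  fixes f :: "'a::euclidean_space \<Rightarrow> real ^ 'n"
  shows "open S \<Longrightarrow> (\<And>i. smooth_on (\<lambda>x. f x $ i) S) \<Longrightarrow> smooth_on f S"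
  unfolding smooth_on_def by (simp add: Ck_on_vec)

lemma smooth_on_inverse:
  fixes f :: "'a::euclidean_space \<Rightarrow> complex"
  assumes "open S" "smooth_on f S" "\<And>x. x \<in> S \<Longrightarrow> f x \<noteq> 0"
  shows "smooth_on (\<lambda>x. inverse (f x)) S"
  using assms Ck_on_inverse
  by (intro smooth_on_compose[where T = "- {0}" and f = f and g = inverse]) (auto simp: smooth_on_def)

lemma smooth_on_Ln:
  fixes f :: "'a::euclidean_space \<Rightarrow> complex"
  assumes "open S" "smooth_on f S" "\<And>x. x \<in> S \<Longrightarrow> f x \<notin> \<real>\<^sub>\<le>\<^sub>0"
  shows "smooth_on (\<lambda>x. Ln (f x)) S"
  using assms Ck_on_Ln
  by (intro smooth_on_compose[where T = "- \<real>\<^sub>\<le>\<^sub>0" and f = f and g = Ln]) (auto simp: smooth_on_def open_Compl)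

lemma smooth_on_exp:
  fixes f :: "'a::euclidean_space \<Rightarrow> complex"
  assumes "open S" "smooth_on f S"
  shows "smooth_on (\<lambda>x. exp (f x)) S"
  using assms Ck_on_exp
  by (intro smooth_on_compose[where T = UNIV and f = f and g = exp]) (auto simp: smooth_on_def)

text \<open>Obtained from the complex logarithm as \<open>Re (Ln x)\<close> on the positive
  reals.\<close>

lemma smooth_on_ln:
  fixes f :: "'a::euclidean_space \<Rightarrow> real"
  assumes "open S" "smooth_on f S" "\<And>x. x \<in> S \<Longrightarrow> f x > 0"
  shows "smooth_on (\<lambda>x. ln (f x)) S"
proof -
  have "smooth_on (\<lambda>x. Re (Ln (of_real (f x)))) S"
    using assms
    by (intro smooth_on_bounded_linear[OF _ bounded_linear_Re] smooth_on_Ln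
        smooth_on_bounded_linear[OF _ bounded_linear_of_real]) force+
  then show ?thesis
    by (rule smooth_on_cong[OF assms(1), rotated]) (use assms in \<open>auto simp: Ln_of_real\<close>)
qed

subsection \<open>Jacobians and compatible charts\<close>

definition jacobian_det :: "(real ^ 'n::finite \<Rightarrow> real ^ 'n) \<Rightarrow> real ^ 'n \<Rightarrow> real" where
  "jacobian_det f x = det (matrix (frechet_derivative f (at x)))"

lemma jacobian_det_eq: "(f has_derivative f') (at x) \<Longrightarrow> jacobian_det f x = det (matrix f')"
  unfolding jacobian_det_def by (simp add: frechet_derivative_at[symmetric])

lemma jacobian_det_compose:
  assumes "(f has_derivative f') (at x)" "(g has_derivative g') (at (f x))"
  shows "jacobian_det (\<lambda>x. g (f x)) x = jacobian_det g (f x) * jacobian_det f x"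
proof -
  have "matrix (\<lambda>h. g' (f' h)) = matrix g' ** matrix f'"
    using matrix_compose[of f' g'] assms[THEN has_derivative_linear] by (simp add: o_def)
  then show ?thesis
    by (simp add: jacobian_det_eq[OF assms(1)] jacobian_det_eq[OF assms(2)]
        jacobian_det_eq[OF has_derivative_compose[OF assms]] det_mul)
qed

lemma jacobian_det_ident: "jacobian_det (\<lambda>x. x) x = 1"
  by (simp add: jacobian_det_def matrix_id_mat_1[unfolded id_def])

lemma jacobian_det_cong:
  assumes "open S" "x \<in> S" "\<And>y. y \<in> S \<Longrightarrow> f y = g y" "f differentiable (at x)"
  shows "jacobian_det f x = jacobian_det g x"
  unfolding jacobian_det_def using frechet_derivative_transform_within_open[OF assms(4,1,2,3)] by simp

text \<open>Covers one direction of the change of charts; the other one is the same condition with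
  \<open>c\<close> and \<open>d\<close> exchanged.\<close>

definition compatible :: "('p, 'n::finite) chart \<Rightarrow> ('p, 'n) chart \<Rightarrow> bool" where
  "compatible c d \<longleftrightarrow> open (rep_dom c d id) \<and> smooth_on (local_rep c d id) (rep_dom c d id) \<and>
     (\<forall>x\<in>rep_dom c d id. jacobian_det (local_rep c d id) x > 0)"

lemma oriented_atlas_iff:
  "oriented_atlas M A \<longleftrightarrow> \<Union>(fst ` A) = M \<and> (\<forall>c\<in>A. inj_on (snd c) (fst c)) \<and>
     (\<forall>c\<in>A. \<forall>d\<in>A. compatible c d)"
  unfolding oriented_atlas_def smooth_map_def orientation_preserving_def compatible_def
    jacobian_det_def by blast

lemma rep_dom_id: "rep_dom (U, \<phi>) (V, \<psi>) id = \<phi> ` (U \<inter> V)"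
  by (simp add: rep_dom_def)

lemma local_rep_chart: "inj_on \<phi> U \<Longrightarrow> p \<in> U \<Longrightarrow> local_rep (U, \<phi>) d f (\<phi> p) = snd d (f p)"
  by (simp add: local_rep_def the_inv_into_f_f)

text \<open>\<open>local_rep\<close> involves \<open>the_inv_into\<close>; this replaces it by an
  explicit formula \<open>F\<close>, since agreement on the open overlap carries smoothness and
  Jacobian over.\<close>

lemma compatibleI:
  assumes "inj_on \<phi> U" "open (\<phi> ` (U \<inter> V))" "smooth_on F (\<phi> ` (U \<inter> V))"
    and "\<And>p. p \<in> U \<inter> V \<Longrightarrow> F (\<phi> p) = \<psi> p" "\<And>p. p \<in> U \<inter> V \<Longrightarrow> jacobian_det F (\<phi> p) > 0"
  shows "compatible (U, \<phi>) (V, \<psi>)"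
proof -
  have eq: "F x = local_rep (U, \<phi>) (V, \<psi>) id x" if "x \<in> \<phi> ` (U \<inter> V)" for x
    using that assms(1,4) by (auto simp: local_rep_chart)
  have "smooth_on (local_rep (U, \<phi>) (V, \<psi>) id) (\<phi> ` (U \<inter> V))"
    using smooth_on_cong[OF assms(2) eq assms(3)] by simp
  moreover have "jacobian_det (local_rep (U, \<phi>) (V, \<psi>) id) x > 0" if "x \<in> \<phi> ` (U \<inter> V)" for x
  proof -
    have "F differentiable at x"
      using smooth_on_has_derivative[OF assms(3) that] by (rule differentiableI)
    then have "jacobian_det F x = jacobian_det (local_rep (U, \<phi>) (V, \<psi>) id) x"
      by (intro jacobian_det_cong[OF assms(2) that eq])
    moreover from that obtain p where "p \<in> U \<inter> V" "x = \<phi> p" by blast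
    ultimately show ?thesis using assms(5)[of p] by simp
  qed
  ultimately show ?thesis
    unfolding compatible_def rep_dom_id using assms(2) by blast
qed

lemma compatible_refl:
  assumes "inj_on \<phi> U" "open (\<phi> ` U)"
  shows "compatible (U, \<phi>) (U, \<phi>)"
proof (rule compatibleI[where F = "\<lambda>x. x"])
  show "smooth_on (\<lambda>x. x) (\<phi> ` (U \<inter> U))"
    using assms by (intro smooth_on_linear bounded_linear_ident) auto
  show "jacobian_det (\<lambda>x. x) (\<phi> p) > 0" for p
    by (simp add: jacobian_det_ident)
qed (use assms in auto)

text \<open>Meant for \<open>\<xi> = c2_coords\<close>: charts that are each comparable with the
  standard coordinates become comparable with each other on their overlap.\<close>

lemma compatible_trans:
  assumes "compatible (U, \<phi>) (U, \<xi>)" "compatible (V, \<xi>) (V, \<psi>)"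
    and "inj_on \<phi> U" "inj_on \<xi> (U \<union> V)"
  shows "compatible (U, \<phi>) (V, \<psi>)"
proof -
  let ?F = "local_rep (U, \<phi>) (U, \<xi>) id" and ?G = "local_rep (V, \<xi>) (V, \<psi>) id"
  have F: "?F (\<phi> p) = \<xi> p" if "p \<in> U" for p
    using that assms(3) by (simp add: local_rep_chart)
  have G: "?G (\<xi> p) = \<psi> p" if "p \<in> V" for p
    using that assms(4) by (simp add: local_rep_chart inj_on_Un)
  have cF: "open (\<phi> ` U)" "smooth_on ?F (\<phi> ` U)" "\<And>x. x \<in> \<phi> ` U \<Longrightarrow> jacobian_det ?F x > 0"
    and cG: "open (\<xi> ` V)" "smooth_on ?G (\<xi> ` V)" "\<And>x. x \<in> \<xi> ` V \<Longrightarrow> jacobian_det ?G x > 0"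
    using assms(1,2) by (auto simp: compatible_def rep_dom_id)
  \<comment> \<open>Exhibits the image of the overlap as a preimage under the continuous
    \<open>?F\<close>, hence as open; injectivity of \<open>\<xi>\<close> across \<open>U\<close>
    and \<open>V\<close> identifies the two points involved.\<close>
  have "\<phi> ` (U \<inter> V) = ?F -` (\<xi> ` V) \<inter> \<phi> ` U"
  proof (intro subset_antisym subsetI)
    fix x assume "x \<in> ?F -` (\<xi> ` V) \<inter> \<phi> ` U"
    then obtain p q where pq: "p \<in> U" "x = \<phi> p" "q \<in> V" "\<xi> p = \<xi> q" by (auto simp: F)
    then have "p = q" by (intro inj_onD[OF assms(4)]) auto
    with pq show "x \<in> \<phi> ` (U \<inter> V)" by auto
  qed (auto simp: F)
  then have op: "open (\<phi> ` (U \<inter> V))"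
    using continuous_on_open_vimage[OF cF(1)] smooth_on_imp_continuous_on[OF cF(2)] cG(1) by metis
  have F': "(?F has_derivative frechet_derivative ?F (at (\<phi> p))) (at (\<phi> p))" if "p \<in> U" for p
    using that by (intro smooth_on_has_derivative[OF cF(2)]) auto
  have G': "(?G has_derivative frechet_derivative ?G (at (\<xi> p))) (at (\<xi> p))" if "p \<in> V" for p
    using that by (intro smooth_on_has_derivative[OF cG(2)]) auto
  show ?thesis
  proof (rule compatibleI[where F = "\<lambda>x. ?G (?F x)", OF assms(3) op])
    show "smooth_on (\<lambda>x. ?G (?F x)) (\<phi> ` (U \<inter> V))"
      by (intro smooth_on_compose[OF op cG(1) _ smooth_on_subset[OF cF(2)] cG(2)]) (auto simp: F)
    fix p assume p: "p \<in> U \<inter> V"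
    then show "?G (?F (\<phi> p)) = \<psi> p" by (simp add: F G)
    show "jacobian_det (\<lambda>x. ?G (?F x)) (\<phi> p) > 0"
    proof -
      have "(?G has_derivative frechet_derivative ?G (at (\<xi> p))) (at (?F (\<phi> p)))"
        using G' p by (simp add: F)
      then have "jacobian_det (\<lambda>x. ?G (?F x)) (\<phi> p) =
          jacobian_det ?G (?F (\<phi> p)) * jacobian_det ?F (\<phi> p)"
        using F' p by (intro jacobian_det_compose) auto
      then show ?thesis using p cF(3)[of "\<phi> p"] cG(3)[of "\<xi> p"] by (simp add: F)
    qed
  qed
qed

text \<open>By the chain rule for \<open>G (F y) = y\<close>, the two Jacobians multiply to
  1.\<close>

lemma inverse_jacobian_det_pos:
  assumes "open S" "x \<in> S" "\<And>y. y \<in> S \<Longrightarrow> G (F y) = y"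
    and "F differentiable at x" "G differentiable at (F x)" "jacobian_det F x > 0"
  shows "jacobian_det G (F x) > 0"
proof -
  have "jacobian_det (\<lambda>y. G (F y)) x = jacobian_det G (F x) * jacobian_det F x"
    using assms(4,5) by (intro jacobian_det_compose) (simp_all add: frechet_derivative_works)
  moreover have "jacobian_det (\<lambda>y. G (F y)) x = jacobian_det (\<lambda>y. y) x"
    using assms(3) differentiable_chain_at[OF assms(4,5)]
    by (intro jacobian_det_cong[OF assms(1,2)]) (simp_all add: o_def)
  ultimately have "0 < jacobian_det G (F x) * jacobian_det F x" by (simp add: jacobian_det_ident)
  then show ?thesis using assms(6) by (simp add: zero_less_mult_iff)
qed

text \<open>Only the Jacobian of \<open>G\<close> has to be computed. In the applications
  \<open>G\<close> is a parametrization by exponentials, while \<open>F\<close> contains logarithms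
  and arguments.\<close>

lemma oriented_atlas_pairI:
  assumes "open (\<phi> ` U)" "open (\<psi> ` U)" "smooth_on F (\<phi> ` U)" "smooth_on G (\<psi> ` U)"
    and "\<And>p. p \<in> U \<Longrightarrow> F (\<phi> p) = \<psi> p" "\<And>p. p \<in> U \<Longrightarrow> G (\<psi> p) = \<phi> p"
    and "inj_on \<phi> U" "\<And>p. p \<in> U \<Longrightarrow> jacobian_det G (\<psi> p) > 0"
  shows "oriented_atlas U {(U, \<phi>), (U, \<psi>)}"
proof -
  have inj: "inj_on \<psi> U"
    using assms(6,7) by (metis inj_on_def)
  have "jacobian_det F (\<phi> p) > 0" if "p \<in> U" for p
  proof -
    have "F differentiable at (\<phi> p)" "G differentiable at (\<psi> p)"
      using smooth_on_has_derivative[OF assms(3)] smooth_on_has_derivative[OF assms(4)] that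
      by (auto simp: differentiable_def)
    then show ?thesis
      using inverse_jacobian_det_pos[OF assms(2), of "\<psi> p" F G] that assms(5,6,8) by force
  qed
  then have "compatible (U, \<phi>) (U, \<psi>)"
    using assms by (intro compatibleI[where F = F]) auto
  moreover have "compatible (U, \<psi>) (U, \<phi>)"
    using assms inj by (intro compatibleI[where F = G]) auto
  ultimately show ?thesis
    using assms(1,2,7) inj by (auto simp: oriented_atlas_iff compatible_refl)
qed

subsection \<open>Restriction of charts to the boundary\<close>

lemma vector_4 [simp]:
  "(vector [x, y, z, w] :: ('a::zero) ^ 4) $ 1 = x"
  "(vector [x, y, z, w] :: ('a::zero) ^ 4) $ 2 = y"
  "(vector [x, y, z, w] :: ('a::zero) ^ 4) $ 3 = z"
  "(vector [x, y, z, w] :: ('a::zero) ^ 4) $ 4 = w"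
  unfolding vector_def by simp_all

lemma det_4:
  "det (A :: 'a::comm_ring_1 ^ 4 ^ 4) =
    A$1$1 * (A$2$2 * A$3$3 * A$4$4 + A$2$3 * A$3$4 * A$4$2 + A$2$4 * A$3$2 * A$4$3
      - A$2$2 * A$3$4 * A$4$3 - A$2$3 * A$3$2 * A$4$4 - A$2$4 * A$3$3 * A$4$2)
    - A$1$2 * (A$2$1 * A$3$3 * A$4$4 + A$2$3 * A$3$4 * A$4$1 + A$2$4 * A$3$1 * A$4$3
      - A$2$1 * A$3$4 * A$4$3 - A$2$3 * A$3$1 * A$4$4 - A$2$4 * A$3$3 * A$4$1)
    + A$1$3 * (A$2$1 * A$3$2 * A$4$4 + A$2$2 * A$3$4 * A$4$1 + A$2$4 * A$3$1 * A$4$2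
      - A$2$1 * A$3$4 * A$4$2 - A$2$2 * A$3$1 * A$4$4 - A$2$4 * A$3$2 * A$4$1)
    - A$1$4 * (A$2$1 * A$3$2 * A$4$3 + A$2$2 * A$3$3 * A$4$1 + A$2$3 * A$3$1 * A$4$2
      - A$2$1 * A$3$3 * A$4$2 - A$2$2 * A$3$1 * A$4$3 - A$2$3 * A$3$2 * A$4$1)"
proof -
  have f: "finite {2::4, 3, 4}" "1 \<notin> {2::4, 3, 4}" "finite {3::4, 4}" "2 \<notin> {3::4, 4}"
    "finite {4::4}" "3 \<notin> {4::4}"
    by auto
  show ?thesis
    unfolding det_def UNIV_4
    unfolding sum_over_permutations_insert[OF f(1,2)]
    unfolding sum_over_permutations_insert[OF f(3,4)]
    unfolding sum_over_permutations_insert[OF f(5,6)]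
    unfolding permutes_sing
    by (simp add: sign_swap_id permutation_swap_id permutation_compose sign_compose sign_id
        swap_id_eq algebra_simps)
qed

definition to_boundary :: "real ^ 4 \<Rightarrow> real ^ 3" where
  "to_boundary x = vector [x $ 2, x $ 3, x $ 4]"

definition from_boundary :: "real ^ 3 \<Rightarrow> real ^ 4" where
  "from_boundary y = vector [0, y $ 1, y $ 2, y $ 3]"

lemma boundary_coords [simp]:
  "to_boundary x $ 1 = x $ 2" "to_boundary x $ 2 = x $ 3" "to_boundary x $ 3 = x $ 4"
  "from_boundary y $ 1 = 0" "from_boundary y $ 2 = y $ 1" "from_boundary y $ 3 = y $ 2"
  "from_boundary y $ 4 = y $ 3"
  by (simp_all add: to_boundary_def from_boundary_def)

lemma from_to_boundary: "x $ 1 = 0 \<Longrightarrow> from_boundary (to_boundary x) = x"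
  by (simp add: vec_eq_iff forall_4)

lemma to_from_boundary [simp]: "to_boundary (from_boundary y) = y"
  by (simp add: vec_eq_iff forall_3)

lemma bounded_linear_boundary: "bounded_linear to_boundary" "bounded_linear from_boundary"
  by (simp_all add: linear_conv_bounded_linear[symmetric] linear_iff vec_eq_iff forall_3 forall_4)

definition boundary_chart :: "('p, 4) chart \<Rightarrow> ('p, 3) chart" where
  "boundary_chart c = ({p \<in> fst c. snd c p $ 1 = 0}, \<lambda>p. to_boundary (snd c p))"

lemma boundary_atlas_eq: "boundary_atlas A = boundary_chart ` A"
  by (auto simp: boundary_atlas_def boundary_chart_def to_boundary_def image_def split_beta)

text \<open>The assumption makes the first row of the matrix \<open>(c, 0, 0, 0)\<close>, so the
  expansion along it leaves a single minor.\<close>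

lemma det_boundary_block:
  fixes L :: "real ^ 4 \<Rightarrow> real ^ 4"
  assumes "\<And>h. L (from_boundary h) $ 1 = 0"
  shows "det (matrix L) = L (axis 1 1) $ 1 * det (matrix (\<lambda>h. to_boundary (L (from_boundary h))))"
proof -
  have ax: "axis 2 1 = from_boundary (axis 1 1)" "axis 3 1 = from_boundary (axis 2 1)"
    "axis 4 1 = from_boundary (axis 3 1)"
    by (simp_all add: vec_eq_iff forall_4 axis_def)
  show ?thesis
    using assms by (simp add: det_4 det_3 matrix_def ax)
qed

lemma inj_on_boundary_chart:
  assumes "inj_on \<Phi> U"
  shows "inj_on (snd (boundary_chart (U, \<Phi>))) (fst (boundary_chart (U, \<Phi>)))"
  using assms unfolding inj_on_def boundary_chart_def by (metis (mono_tags, lifting) CollectD fst_conv from_to_boundary snd_conv)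

text \<open>Both charts carry \<open>D\<close> to the half-space, so the transition preserves the
  half-space and its bounding hyperplane. \<open>U\<close> and \<open>V\<close> are the full chart
  domains, not cut down to \<open>D\<close>, so the transition is differentiable across the
  hyperplane.\<close>

lemma compatible_boundary_chart:
  fixes D :: "'p set"
  assumes comp: "compatible (U, \<Phi>) (V, \<Psi>)" and inj: "inj_on \<Phi> U"
    and U: "\<And>p. p \<in> U \<Longrightarrow> p \<in> D \<longleftrightarrow> \<Phi> p $ 1 \<le> 0"
    and V: "\<And>p. p \<in> V \<Longrightarrow> p \<in> D \<longleftrightarrow> \<Psi> p $ 1 \<le> 0"
  shows "compatible (boundary_chart (U \<inter> D, \<Phi>)) (boundary_chart (V \<inter> D, \<Psi>))"
proof -
  let ?T = "local_rep (U, \<Phi>) (V, \<Psi>) id" and ?O = "\<Phi> ` (U \<inter> V)"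
  let ?U = "{p \<in> U \<inter> D. \<Phi> p $ 1 = 0}" and ?V = "{p \<in> V \<inter> D. \<Psi> p $ 1 = 0}"
  let ?t = "\<lambda>y. to_boundary (?T (from_boundary y))"
  have T: "?T (\<Phi> p) = \<Psi> p" if "p \<in> U" for p
    using that inj by (simp add: local_rep_chart)
  have op: "open ?O" and smT: "smooth_on ?T ?O" and jac: "\<And>x. x \<in> ?O \<Longrightarrow> jacobian_det ?T x > 0"
    using comp by (auto simp: compatible_def rep_dom_id)
  have half: "?T x $ 1 \<le> 0 \<longleftrightarrow> x $ 1 \<le> 0" if "x \<in> ?O" for x
    using that U V by (metis IntD1 IntD2 T imageE)
  \<comment> \<open>If \<open>x\<close> were sent to the open half-space, then by continuity so
    would be the points \<open>x + s e1\<close> with small \<open>s > 0\<close>, although these lie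
    outside the half-space.\<close>
  have Tb: "?T x $ 1 = 0" if x: "x \<in> ?O" "x $ 1 = 0" for x
  proof (rule ccontr)
    assume "?T x $ 1 \<noteq> 0"
    then have neg: "?T x $ 1 < 0" using half[OF x(1)] x(2) by simp
    have "isCont ?T x"
      using smooth_on_imp_continuous_on[OF smT] op x(1) continuous_on_eq_continuous_at by blast
    moreover have "((\<lambda>s. x + s *\<^sub>R axis 1 1) \<longlongrightarrow> x + 0 *\<^sub>R axis 1 1) (at_right (0::real))"
      by (intro tendsto_intros)
    ultimately have "((\<lambda>s. ?T (x + s *\<^sub>R axis 1 1) $ 1) \<longlongrightarrow> ?T x $ 1) (at_right 0)"
      by (auto intro!: tendsto_vec_nth isCont_tendsto_compose[of x ?T])
    then have "\<forall>\<^sub>F s in at_right 0. ?T (x + s *\<^sub>R axis 1 1) $ 1 < 0"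
      using neg by (rule order_tendstoD)
    moreover have "\<forall>\<^sub>F s in at_right (0::real). x + s *\<^sub>R axis 1 1 \<in> ?O"
      by (rule topological_tendstoD[OF _ op]) (auto intro!: tendsto_eq_intros x(1))
    moreover have "\<forall>\<^sub>F s in at_right (0::real). s > 0" by (simp add: eventually_at_right_less)
    ultimately have "\<forall>\<^sub>F s in at_right (0::real). False"
    proof eventually_elim
      case (elim s)
      then show False using half[of "x + s *\<^sub>R axis 1 1"] x(2) by simp
    qed
    then show False by (simp add: trivial_limit_at_right_real eventually_False)
  qed
  \<comment> \<open>By \<open>Tb\<close>, a vanishing first coordinate in one chart forces it to
    vanish in the other; so the overlap of the boundary charts is the full slice of the
    overlap.\<close>
  have dom: "to_boundary ` \<Phi> ` (?U \<inter> ?V) = from_boundary -` ?O"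
  proof (intro subset_antisym subsetI)
    fix y assume "y \<in> from_boundary -` ?O"
    then obtain p where p: "p \<in> U \<inter> V" "from_boundary y = \<Phi> p" by auto
    then have z: "\<Phi> p $ 1 = 0" by (metis boundary_coords(4))
    with Tb[of "\<Phi> p"] p(1) have "\<Psi> p $ 1 = 0" by (auto simp: T)
    with p z U show "y \<in> to_boundary ` \<Phi> ` (?U \<inter> ?V)"
      by (intro rev_image_eqI[of "\<Phi> p"] imageI) (auto simp: p(2)[symmetric])
  qed (auto simp: from_to_boundary)
  have opb: "open (from_boundary -` ?O)"
    using open_vimage[OF op linear_continuous_on[OF bounded_linear_boundary(2)]] by simp
  have smt: "smooth_on ?t (from_boundary -` ?O)"
    by (intro smooth_on_bounded_linear[OF _ bounded_linear_boundary(1)] opb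
        smooth_on_compose[OF opb op _ _ smT] smooth_on_linear bounded_linear_boundary(2)) auto
  have pos: "jacobian_det ?t y > 0" if y: "from_boundary y \<in> ?O" for y
  proof -
    define L where "L = frechet_derivative ?T (at (from_boundary y))"
    have L: "(?T has_derivative L) (at (from_boundary y))"
      unfolding L_def by (rule smooth_on_has_derivative[OF smT y])
    have i: "(from_boundary has_derivative from_boundary) (at y)" for y
      by (rule bounded_linear_imp_has_derivative[OF bounded_linear_boundary(2)])
    have Li: "((\<lambda>y. ?T (from_boundary y)) has_derivative (\<lambda>h. L (from_boundary h))) (at y)"
      by (rule has_derivative_compose[OF i L])
    have "((\<lambda>y. ?T (from_boundary y) $ 1) has_derivative (\<lambda>h. L (from_boundary h) $ 1)) (at y)"
      by (rule bounded_linear.has_derivative[OF bounded_linear_vec_nth Li])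
    moreover have "((\<lambda>y. ?T (from_boundary y) $ 1) has_derivative (\<lambda>h. 0)) (at y)"
      by (rule has_derivative_transform_within_open[OF has_derivative_const[of 0] opb])
        (use y Tb in auto)
    \<comment> \<open>The boundary is preserved, so the first row of \<open>L\<close> is \<open>(c, 0, 0, 0)\<close>; \<open>c \<ge> 0\<close> because the
      half-space is preserved too.\<close>
    ultimately have row: "L (from_boundary h) $ 1 = 0" for h
      by (metis has_derivative_unique)
    have "(?t has_derivative (\<lambda>h. to_boundary (L (from_boundary h)))) (at y)"
      by (rule bounded_linear.has_derivative[OF bounded_linear_boundary(1) Li])
    then have "0 < L (axis 1 1) $ 1 * jacobian_det ?t y"
      using jac[OF y] det_boundary_block[of L, OF row] by (simp add: jacobian_det_eq[OF L] jacobian_det_eq)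
    moreover have "L (axis 1 1) $ 1 \<ge> 0"
    proof (rule ccontr)
      assume "\<not> L (axis 1 1) $ 1 \<ge> 0"
      then have neg: "L (axis 1 1) $ 1 < 0" by simp
      let ?l = "\<lambda>s::real. from_boundary y + s *\<^sub>R axis 1 1"
      have l: "(?l has_derivative (\<lambda>s. s *\<^sub>R axis 1 1)) (at 0)"
        by (auto intro!: derivative_eq_intros)
      have "((\<lambda>s. ?T (?l s)) has_derivative (\<lambda>s. L (s *\<^sub>R axis 1 1))) (at 0)"
        by (rule has_derivative_compose[OF l]) (simp only: scaleR_zero_left add_0_right L)
      then have "((\<lambda>s. ?T (?l s) $ 1) has_derivative (\<lambda>s. L (s *\<^sub>R axis 1 1) $ 1)) (at 0)"
        by (rule bounded_linear.has_derivative[OF bounded_linear_vec_nth])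
      moreover have "L (s *\<^sub>R axis 1 1) $ 1 = L (axis 1 1) $ 1 * s" for s
        using linear_scale[OF has_derivative_linear[OF L]] by simp
      ultimately have "DERIV (\<lambda>s. ?T (?l s) $ 1) 0 :> L (axis 1 1) $ 1"
        by (simp add: has_field_derivative_def)
      \<comment> \<open>With a negative slope the first coordinate would rise above 0 on moving
        inwards, that is, leave the half-space.\<close>
      from DERIV_neg_dec_left[OF this neg] obtain d
        where d: "d > 0" "\<And>h. 0 < h \<Longrightarrow> h < d \<Longrightarrow> ?T (?l 0) $ 1 < ?T (?l (0 - h)) $ 1"
        by blast
      have "\<forall>\<^sub>F s in at_right (0::real). from_boundary y + (- s) *\<^sub>R axis 1 1 \<in> ?O"
        by (rule topological_tendstoD[OF _ op]) (auto intro!: tendsto_eq_intros y)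
      moreover have "\<forall>\<^sub>F s in at_right (0::real). 0 < s \<and> s < d"
        using d(1) by (auto simp: eventually_at_right_field)
      ultimately have "\<forall>\<^sub>F s in at_right (0::real). False"
      proof eventually_elim
        case (elim s)
        then show False using d(2)[of s] half[of "?l (- s)"] Tb[OF y] by simp
      qed
      then show False by (simp add: trivial_limit_at_right_real eventually_False)
    qed
    \<comment> \<open>Nonnegativity of the normal factor suffices: the product is positive, so the
      factor cannot vanish.\<close>
    ultimately show ?thesis by (simp add: zero_less_mult_iff)
  qed
  have "compatible (?U, \<lambda>p. to_boundary (\<Phi> p)) (?V, \<lambda>p. to_boundary (\<Psi> p))"
  proof (rule compatibleI[where F = ?t])
    show "inj_on (\<lambda>p. to_boundary (\<Phi> p)) ?U"
      using inj_on_boundary_chart[of \<Phi> "U \<inter> D"] inj_on_subset[OF inj] by (simp add: boundary_chart_def)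
  qed (use dom opb smt in \<open>auto simp: image_image from_to_boundary T intro!: pos\<close>)
  then show ?thesis by (simp add: boundary_chart_def)
qed

subsection \<open>Polar coordinates\<close>

definition c2_point :: "real ^ 4 \<Rightarrow> complex \<times> complex" where
  "c2_point x = (Complex (x $ 1) (x $ 2), Complex (x $ 3) (x $ 4))"

lemma c2_point_coords [simp]: "c2_point (c2_coords p) = p"
  by (cases p) (simp add: c2_point_def)

lemma c2_coords_point [simp]: "c2_coords (c2_point x) = x"
  by (simp add: c2_point_def vec_eq_iff forall_4)

lemma inj_c2_coords: "inj_on c2_coords W"
  by (metis c2_point_coords inj_onI)

lemma bounded_linear_c2_coords: "bounded_linear c2_coords"
proof -
  have "linear c2_coords"
    by (auto simp: linear_iff vec_eq_iff forall_4 split_paired_all)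
  then show ?thesis by (simp add: linear_conv_bounded_linear)
qed

lemma bounded_linear_Complex_nth: "bounded_linear (\<lambda>x :: real ^ 'n. Complex (x $ i) (x $ j))"
  by (simp add: linear_conv_bounded_linear[symmetric] linear_iff complex_eq_iff)

lemma c2_coords_image: "c2_coords ` W = c2_point -` W"
  by (auto simp del: c2_coords.simps) (metis c2_coords_point image_eqI)

lemma open_c2_coords_image: "open W \<Longrightarrow> open (c2_coords ` W)"
  unfolding c2_coords_image c2_point_def
  by (intro open_vimage continuous_on_Pair linear_continuous_on bounded_linear_Complex_nth)

lemma smooth_on_c2_coords:
  assumes "open S" "smooth_on f S" "smooth_on g S"
  shows "smooth_on (\<lambda>x. c2_coords (f x, g x)) S"
proof (rule smooth_on_vec[OF assms(1)])
  show "smooth_on (\<lambda>x. c2_coords (f x, g x) $ i) S" for i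
    using exhaust_4[of i] smooth_on_bounded_linear[OF assms(1) bounded_linear_Re]
      smooth_on_bounded_linear[OF assms(1) bounded_linear_Im] assms(2,3)
    by auto
qed

text \<open>The plane without the closed ray of argument \<open>a\<close>, and the argument with values in
  \<open>(a, a + 2\<pi>)\<close> on it.\<close>
definition slit :: "real \<Rightarrow> complex set" where
  "slit a = {z. z * cis (- (a + pi)) \<notin> \<real>\<^sub>\<le>\<^sub>0}"

definition arg_branch :: "real \<Rightarrow> complex \<Rightarrow> real" where
  "arg_branch a z = a + pi + Im (Ln (z * cis (- (a + pi))))"

lemma open_slit: "open (slit a)"
proof -
  have "open ((\<lambda>z. z * cis (- (a + pi))) -` (- \<real>\<^sub>\<le>\<^sub>0))"
    by (intro open_vimage continuous_intros) (simp add: open_Compl)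
  then show ?thesis by (simp add: slit_def vimage_def)
qed

lemma slit_nonzero: "z \<in> slit a \<Longrightarrow> z \<noteq> 0"
  by (auto simp: slit_def)

text \<open>The rotation by \<open>cis (- (a + pi))\<close> carries the ray of argument
  \<open>a\<close> onto the cut of \<open>Ln\<close>; \<open>arg_branch\<close> adds the angle
  \<open>a + pi\<close> back.\<close>

lemma arg_branch:
  assumes "z \<in> slit a"
  shows "a < arg_branch a z" "arg_branch a z < a + 2 * pi"
    and "of_real (cmod z) * cis (arg_branch a z) = z"
proof -
  let ?w = "z * cis (- (a + pi))"
  have w: "?w \<notin> \<real>\<^sub>\<le>\<^sub>0" using assms by (simp add: slit_def)
  then have "?w \<noteq> 0" by auto
  then have "Im (Ln ?w) < pi" "- pi < Im (Ln ?w)"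
    using Im_Ln_less_pi[OF w] mpi_less_Im_Ln by auto
  then show "a < arg_branch a z" "arg_branch a z < a + 2 * pi"
    by (auto simp: arg_branch_def)
  from \<open>?w \<noteq> 0\<close> have "?w = exp (Ln ?w)" by simp
  also have "\<dots> = of_real (cmod z) * cis (Im (Ln ?w))"
    using \<open>?w \<noteq> 0\<close> by (simp add: exp_eq_polar Re_Ln norm_mult)
  finally have "of_real (cmod z) * cis (Im (Ln ?w)) * cis (a + pi) = ?w * cis (a + pi)" by simp
  then show "of_real (cmod z) * cis (arg_branch a z) = z"
    by (simp add: arg_branch_def cis_mult mult.assoc add.commute)
qed

text \<open>The converse of \<open>arg_branch\<close>: together they make polar coordinates a
  bijection onto the slit plane.\<close>

lemma polar_slit:
  assumes "r > 0" "a < t" "t < a + 2 * pi"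
  shows "of_real r * cis t \<in> slit a" "arg_branch a (of_real r * cis t) = t"
proof -
  let ?s = "t - (a + pi)"
  have eq: "of_real r * cis t * cis (- (a + pi)) = exp (Complex (ln r) ?s)"
    using assms(1) by (simp add: mult.assoc cis_mult exp_eq_polar algebra_simps)
  have "Ln (exp (Complex (ln r) ?s)) = Complex (ln r) ?s"
    using assms by (intro Ln_exp) auto
  then have Ln: "Im (Ln (of_real r * cis t * cis (- (a + pi)))) = ?s"
    using eq by simp
  then show "arg_branch a (of_real r * cis t) = t" by (simp add: arg_branch_def)
  show "of_real r * cis t \<in> slit a"
    unfolding slit_def mem_Collect_eq
  proof
    assume n: "of_real r * cis t * cis (- (a + pi)) \<in> \<real>\<^sub>\<le>\<^sub>0"
    moreover have "of_real r * cis t * cis (- (a + pi)) \<noteq> 0" unfolding eq by simp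
    \<comment> \<open>On its cut \<open>Ln\<close> has imaginary part \<open>pi\<close>, whereas
      \<open>t < a + 2 * pi\<close> gives \<open>?s < pi\<close>.\<close>
    ultimately have "Im (Ln (of_real r * cis t * cis (- (a + pi)))) = pi"
      by (auto simp: Im_Ln_eq_pi complex_nonpos_Reals_iff complex_eq_iff intro: le_neq_trans)
    with Ln assms show False by simp
  qed
qed

lemma smooth_on_arg_branch:
  assumes "open S" "smooth_on f S" "f ` S \<subseteq> slit a"
  shows "smooth_on (\<lambda>x. arg_branch a (f x)) S"
  unfolding arg_branch_def using assms
  by (intro smooth_on_add smooth_on_const smooth_on_bounded_linear[OF _ bounded_linear_Im]
      smooth_on_Ln smooth_on_mult) (auto simp: slit_def)

section \<open>Angles modulo full turns and their real branches\<close>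

lemma angle_branch_to_angle:
  assumes "a < t" "t < a + 2 * pi"
  shows "angle_branch a (to_angle t) = t"
  unfolding angle_branch_def
proof (rule the_equality)
  fix s assume s: "a < s \<and> s < a + 2 * pi \<and> to_angle s = to_angle t"
  then obtain k :: int where k: "t - s = 2 * pi * of_int k" by (auto simp: to_angle_eq_iff)
  then have "2 * pi * of_int k < 2 * pi * 1" "2 * pi * (- 1) < 2 * pi * of_int k"
    using s assms by linarith+
  then have "of_int k < (1 :: real)" "(- 1 :: real) < of_int k"
    by (simp_all only: mult_less_cancel_left_pos pi_gt_zero zero_less_mult_iff zero_less_numeral simp_thms)
  then have "k = 0" by linarith
  with k show "s = t" by simp
qed (use assms in auto)

lemma arg_polar: "r > 0 \<Longrightarrow> arg (of_real r * cis t) = to_angle t"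
  using cis_angle_arg[of "of_real r * cis t"]
  by (simp add: norm_mult cis_angle_inj[symmetric] cis_angle_to_angle)

lemma arg_slit: "z \<in> slit a \<Longrightarrow> arg z = to_angle (arg_branch a z)"
  by (metis arg_branch(3) arg_polar slit_nonzero zero_less_norm_iff)

subsection \<open>The boundary of a domain\<close>

text \<open>Injectivity of \<open>\<Phi>\<close> turns the equation between images in
  \<open>domain_atlas\<close> into a criterion for single points.\<close>

lemma domain_atlasD:
  assumes "c \<in> domain_atlas D"
  obtains W \<Phi> where "c = (W \<inter> D, \<Phi>)" "open W" "inj_on \<Phi> W"
    "compatible (W, \<Phi>) (W, c2_coords)" "compatible (W, c2_coords) (W, \<Phi>)"
    "\<And>p. p \<in> W \<Longrightarrow> p \<in> D \<longleftrightarrow> \<Phi> p $ 1 \<le> 0"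
proof -
  obtain W \<Phi> where c: "c = (W \<inter> D, \<Phi>)" "open W" "oriented_atlas W {(W, c2_coords), (W, \<Phi>)}"
    "\<Phi> ` (W \<inter> D) = \<Phi> ` W \<inter> half_space"
    using assms by (auto simp: domain_atlas_def)
  then have inj: "inj_on \<Phi> W" by (simp add: oriented_atlas_iff)
  have "p \<in> D \<longleftrightarrow> \<Phi> p $ 1 \<le> 0" if "p \<in> W" for p
  proof
    assume "p \<in> D"
    with that c(4) have "\<Phi> p \<in> half_space" by blast
    then show "\<Phi> p $ 1 \<le> 0" by (simp add: half_space_def)
  next
    assume "\<Phi> p $ 1 \<le> 0"
    with that c(4) have "\<Phi> p \<in> \<Phi> ` (W \<inter> D)" by (simp add: half_space_def)
    then obtain q where "q \<in> W \<inter> D" "\<Phi> p = \<Phi> q" by blast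
    with inj that show "p \<in> D" by (metis IntD1 IntD2 inj_onD)
  qed
  then show ?thesis using c inj by (intro that[of W \<Phi>]) (auto simp: oriented_atlas_iff)
qed

text \<open>Two arbitrary straightening charts are compared by way of \<open>c2_coords\<close>, and
  the resulting transition is then restricted.\<close>

lemma domain_boundary_compatible:
  assumes "c \<in> domain_atlas D" "d \<in> domain_atlas D"
  shows "compatible (boundary_chart c) (boundary_chart d)"
proof -
  obtain W \<Phi> where c: "c = (W \<inter> D, \<Phi>)" "open W" "inj_on \<Phi> W"
      "compatible (W, \<Phi>) (W, c2_coords)" "compatible (W, c2_coords) (W, \<Phi>)"
      "\<And>p. p \<in> W \<Longrightarrow> p \<in> D \<longleftrightarrow> \<Phi> p $ 1 \<le> 0"
    by (rule domain_atlasD[OF assms(1)]) blast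
  obtain V \<Psi> where d: "d = (V \<inter> D, \<Psi>)" "open V" "inj_on \<Psi> V"
      "compatible (V, \<Psi>) (V, c2_coords)" "compatible (V, c2_coords) (V, \<Psi>)"
      "\<And>p. p \<in> V \<Longrightarrow> p \<in> D \<longleftrightarrow> \<Psi> p $ 1 \<le> 0"
    by (rule domain_atlasD[OF assms(2)]) blast
  have "compatible (W, \<Phi>) (V, \<Psi>)"
    by (rule compatible_trans[OF c(4) d(5) c(3) inj_c2_coords])
  then show ?thesis
    unfolding c(1) d(1) by (rule compatible_boundary_chart[OF _ c(3) c(6) d(6)])
qed

text \<open>Near an interior point of \<open>D\<close> the chart has an open image, which would
  contain points with positive first coordinate. For the ball this keeps all boundary charts on the
  sphere.\<close>

lemma domain_boundary_subset_frontier: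
  assumes "c \<in> domain_atlas D"
  shows "fst (boundary_chart c) \<subseteq> D - interior D"
proof
  obtain W \<Phi> where c: "c = (W \<inter> D, \<Phi>)" "open W" "inj_on \<Phi> W"
      "compatible (W, \<Phi>) (W, c2_coords)" "compatible (W, c2_coords) (W, \<Phi>)"
      "\<And>p. p \<in> W \<Longrightarrow> p \<in> D \<longleftrightarrow> \<Phi> p $ 1 \<le> 0"
    by (rule domain_atlasD[OF assms]) blast
  fix p assume "p \<in> fst (boundary_chart c)"
  then have p: "p \<in> W" "p \<in> D" "\<Phi> p $ 1 = 0" by (auto simp: boundary_chart_def c(1))
  have "p \<notin> interior D"
  proof
    assume int: "p \<in> interior D"
    let ?I = "W \<inter> interior D"
    have "compatible (?I, c2_coords) (?I, c2_coords)"
      by (intro compatible_refl inj_c2_coords open_c2_coords_image open_Int c(2) open_interior)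
    then have "compatible (W, \<Phi>) (?I, c2_coords)"
      by (rule compatible_trans[OF c(4) _ c(3) inj_c2_coords])
    then have op: "open (\<Phi> ` ?I)" by (simp add: compatible_def rep_dom_id)
    have "\<forall>\<^sub>F s in at_right (0::real). \<Phi> p + s *\<^sub>R axis 1 1 \<in> \<Phi> ` ?I"
      by (rule topological_tendstoD[OF _ op]) (use p int in \<open>auto intro!: tendsto_eq_intros\<close>)
    moreover have "\<forall>\<^sub>F s in at_right (0::real). s > 0" by (simp add: eventually_at_right_less)
    ultimately have "\<forall>\<^sub>F s in at_right (0::real). False"
    proof eventually_elim
      case (elim s)
      then obtain q where q: "q \<in> W" "q \<in> interior D" "\<Phi> p + s *\<^sub>R axis 1 1 = \<Phi> q" by auto
      then have "\<Phi> q $ 1 \<le> 0" using c(6) interior_subset by blast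
      then show False using q(3)[symmetric] p(3) elim(2) by simp
    qed
    then show False by (simp add: trivial_limit_at_right_real eventually_False)
  qed
  with p show "p \<in> D - interior D" by simp
qed

subsection \<open>Charts of the 3-sphere adapted to the Hopf fibration\<close>

text \<open>Puts the coordinate that is divided by first, so that both charts share one formula.
  Exchanging the two complex coordinates is an even permutation of the four real ones and costs no
  sign.\<close>

fun swap_to :: "chart_index \<Rightarrow> complex \<times> complex \<Rightarrow> complex \<times> complex" where
  "swap_to First (z, w) = (z, w)"
| "swap_to Second (z, w) = (w, z)"

lemma swap_to_swap_to [simp]: "swap_to j (swap_to j p) = p"
  by (cases p; cases j) auto

lemma norm_swap_to [simp]: "norm (swap_to j p) = norm p"
  by (cases p; cases j) (auto simp: norm_Pair add.commute)

lemma bounded_linear_swap_to: "bounded_linear (swap_to j)"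
proof -
  have "linear (swap_to j)" by (cases j) (auto simp: linear_iff split_paired_all)
  then show ?thesis by (simp add: linear_conv_bounded_linear)
qed

definition hopf_dom :: "chart_index \<Rightarrow> real \<Rightarrow> (complex \<times> complex) set" where
  "hopf_dom j a = {p. fst (swap_to j p) \<in> slit a}"

text \<open>With \<open>p = (z, w)\<close> after the swap, \<open>ln \<bar>p\<bar>\<close> straightens the unit ball, and on the sphere the
  remaining coordinates are those of the image of \<open>p\<close> under the map of the theorem. The inverse
  \<open>hopf_point\<close> solves \<open>\<bar>p\<bar>\<^sup>2 = \<bar>z\<bar>\<^sup>2 (1 + \<bar>w/z\<bar>\<^sup>2)\<close> for \<open>\<bar>z\<bar>\<close>.\<close>
fun hopf_coords :: "real \<Rightarrow> complex \<times> complex \<Rightarrow> real ^ 4" where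
  "hopf_coords a (z, w) = vector [ln (norm (z, w)), arg_branch a z, Re (w / z), Im (w / z)]"

text \<open>Equals \<open>ln |z|\<close>, expressed through \<open>ln |p|\<close> and
  \<open>v = w / z\<close>.\<close>

definition hopf_scale :: "real ^ 4 \<Rightarrow> real" where
  "hopf_scale x = x $ 1 - ln (1 + (x $ 3)\<^sup>2 + (x $ 4)\<^sup>2) / 2"

definition hopf_base :: "real ^ 4 \<Rightarrow> complex" where
  "hopf_base x = exp (of_real (hopf_scale x) + of_real (x $ 2) * \<i>)"

definition hopf_point :: "real ^ 4 \<Rightarrow> complex \<times> complex" where
  "hopf_point x = (hopf_base x, hopf_base x * Complex (x $ 3) (x $ 4))"

lemma hopf_point_coords:
  assumes "fst p \<in> slit a"
  shows "hopf_point (hopf_coords a p) = p"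
proof -
  obtain z w where p: "p = (z, w)" by (cases p)
  have z: "z \<in> slit a" "z \<noteq> 0" using assms slit_nonzero p by auto
  have n: "(norm (z, w))\<^sup>2 = (cmod z)\<^sup>2 * (1 + (cmod (w / z))\<^sup>2)"
    using z(2) by (simp add: norm_Pair norm_divide field_simps)
  have pos: "norm (z, w) > 0" using z(2) by (simp add: norm_Pair add_pos_nonneg)
  have "2 * ln (norm (z, w)) = ln ((norm (z, w))\<^sup>2)" using pos by (simp add: ln_realpow)
  also have "\<dots> = 2 * ln (cmod z) + ln (1 + (cmod (w / z))\<^sup>2)"
    unfolding n using z(2) add_pos_nonneg[OF zero_less_one zero_le_power2[of "cmod (w / z)"]]
    by (subst ln_mult) (simp_all add: ln_realpow)
  finally have "hopf_scale (hopf_coords a p) = ln (cmod z)"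
    by (simp add: hopf_scale_def p cmod_power2 add.assoc)
  then have "hopf_base (hopf_coords a p) = z"
    using arg_branch(3)[OF z(1)] z(2)
    by (simp add: hopf_base_def p exp_add exp_of_real cis_conv_exp mult.commute)
  then show ?thesis
    using z(2) by (simp add: hopf_point_def p)
qed

lemma hopf_coords_point:
  assumes "a < x $ 2" "x $ 2 < a + 2 * pi"
  shows "fst (hopf_point x) \<in> slit a" "hopf_coords a (hopf_point x) = x"
proof -
  let ?v = "Complex (x $ 3) (x $ 4)"
  have base: "hopf_base x = of_real (exp (hopf_scale x)) * cis (x $ 2)"
    by (simp add: hopf_base_def exp_add exp_of_real cis_conv_exp mult.commute)
  show slit: "fst (hopf_point x) \<in> slit a"
    using polar_slit(1)[OF _ assms] by (simp add: hopf_point_def base)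
  have nz: "hopf_base x \<noteq> 0" by (simp add: hopf_base_def)
  have nb: "cmod (hopf_base x) = exp (hopf_scale x)" by (simp add: base norm_mult)
  have v: "1 + (cmod ?v)\<^sup>2 = 1 + (x $ 3)\<^sup>2 + (x $ 4)\<^sup>2" by (simp add: cmod_power2)
  have "(norm (hopf_point x))\<^sup>2 = (exp (hopf_scale x))\<^sup>2 * (1 + (cmod ?v)\<^sup>2)"
    by (simp add: hopf_point_def norm_Pair nb norm_mult algebra_simps power_mult_distrib)
  then have "ln ((norm (hopf_point x))\<^sup>2) = 2 * hopf_scale x + ln (1 + (cmod ?v)\<^sup>2)"
    using add_pos_nonneg[OF zero_less_one zero_le_power2[of "cmod ?v"]]
    by (simp only:, subst ln_mult) (simp_all add: ln_realpow)
  moreover have "norm (hopf_point x) > 0" using nz by (simp add: hopf_point_def norm_Pair add_pos_nonneg)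
  ultimately have "ln (norm (hopf_point x)) = x $ 1"
    using v by (simp add: ln_realpow hopf_scale_def)
  moreover have "arg_branch a (hopf_base x) = x $ 2"
    unfolding base using polar_slit(2)[OF _ assms] by simp
  ultimately show "hopf_coords a (hopf_point x) = x"
    using nz by (simp add: hopf_point_def vec_eq_iff forall_4)
qed

text \<open>\<open>N\<close> is the derivative of \<open>hopf_scale\<close>. Its values on the first
  two axes are all that the determinant depends on: on the other two axes it contributes multiples
  of the first column.\<close>

lemma hopf_point_has_derivative:
  obtains N where "N (axis 1 1) = 1" "N (axis 2 1) = 0"
    "(hopf_point has_derivative (\<lambda>h.
       (hopf_base x * (of_real (N h) + of_real (h $ 2) * \<i>),
        hopf_base x * (of_real (N h) + of_real (h $ 2) * \<i>) * Complex (x $ 3) (x $ 4)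
          + hopf_base x * Complex (h $ 3) (h $ 4)))) (at x)"
proof -
  have pos: "1 + (x $ 3)\<^sup>2 + (x $ 4)\<^sup>2 > 0" by (simp add: add_pos_nonneg)
  define N where "N h = h $ 1 - (2 * x $ 3 * h $ 3 + 2 * x $ 4 * h $ 4) / (1 + (x $ 3)\<^sup>2 + (x $ 4)\<^sup>2) / 2"
    for h :: "real ^ 4"
  have nth: "((\<lambda>x :: real ^ 4. x $ i) has_derivative (\<lambda>h. h $ i)) (at x)" for i
    by (rule bounded_linear_imp_has_derivative[OF bounded_linear_vec_nth])
  have "((\<lambda>x :: real ^ 4. ln (1 + (x $ 3)\<^sup>2 + (x $ 4)\<^sup>2)) has_derivative
      (\<lambda>h. (2 * x $ 3 * h $ 3 + 2 * x $ 4 * h $ 4) / (1 + (x $ 3)\<^sup>2 + (x $ 4)\<^sup>2))) (at x)"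
    using pos by (auto intro!: derivative_eq_intros nth simp: field_simps)
  then have S: "(hopf_scale has_derivative N) (at x)"
    unfolding hopf_scale_def[abs_def] N_def[abs_def]
    by (intro has_derivative_diff nth bounded_linear.has_derivative[OF bounded_linear_divide])
  have "((\<lambda>x :: real ^ 4. of_real (hopf_scale x) + of_real (x $ 2) * \<i>) has_derivative
      (\<lambda>h. of_real (N h) + of_real (h $ 2) * \<i>)) (at x)"
    by (intro has_derivative_add has_derivative_mult_left nth S
        bounded_linear.has_derivative[OF bounded_linear_of_real])
  from has_derivative_compose[OF this DERIV_exp[unfolded has_field_derivative_def]]
  have "(hopf_base has_derivative (\<lambda>h. hopf_base x * (of_real (N h) + of_real (h $ 2) * \<i>))) (at x)"
    unfolding hopf_base_def[abs_def] .
  moreover have "((\<lambda>x :: real ^ 4. Complex (x $ 3) (x $ 4)) has_derivative (\<lambda>h. Complex (h $ 3) (h $ 4))) (at x)"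
    by (rule bounded_linear_imp_has_derivative[OF bounded_linear_Complex_nth])
  ultimately have "(hopf_point has_derivative (\<lambda>h.
       (hopf_base x * (of_real (N h) + of_real (h $ 2) * \<i>),
        hopf_base x * (of_real (N h) + of_real (h $ 2) * \<i>) * Complex (x $ 3) (x $ 4)
          + hopf_base x * Complex (h $ 3) (h $ 4)))) (at x)"
    unfolding hopf_point_def[abs_def]
    by (auto intro!: derivative_eq_intros simp: algebra_simps)
  moreover have "N (axis 1 1) = 1" "N (axis 2 1) = 0" by (simp_all add: axis_def N_def)
  ultimately show ?thesis by (rule that[rotated 2])
qed

lemma jacobian_det_hopf_point: "jacobian_det (\<lambda>x. c2_coords (swap_to j (hopf_point x))) x > 0"
proof -
  obtain N where N: "N (axis 1 1) = 1" "N (axis 2 1) = 0"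
    "(hopf_point has_derivative (\<lambda>h.
       (hopf_base x * (of_real (N h) + of_real (h $ 2) * \<i>),
        hopf_base x * (of_real (N h) + of_real (h $ 2) * \<i>) * Complex (x $ 3) (x $ 4)
          + hopf_base x * Complex (h $ 3) (h $ 4)))) (at x)" (is "(_ has_derivative ?H) _")
    by (rule hopf_point_has_derivative)
  have "((\<lambda>x. c2_coords (swap_to j (hopf_point x))) has_derivative (\<lambda>h. c2_coords (swap_to j (?H h)))) (at x)"
    by (intro bounded_linear.has_derivative[OF bounded_linear_c2_coords]
        bounded_linear.has_derivative[OF bounded_linear_swap_to] N(3))
  then have "jacobian_det (\<lambda>x. c2_coords (swap_to j (hopf_point x))) x =
      det (matrix (\<lambda>h. c2_coords (swap_to j (?H h))))"
    by (rule jacobian_det_eq)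
  \<comment> \<open>Up to column operations the matrix is block triangular, with multiplication by
    \<open>hopf_base x\<close> as both diagonal blocks; each contributes the squared
    modulus.\<close>
  also have "\<dots> = ((Re (hopf_base x))\<^sup>2 + (Im (hopf_base x))\<^sup>2)\<^sup>2"
  proof -
    have ax: "axis i (1 :: real) $ k = (if k = i then 1 else 0)" for i k :: 4 by (simp add: axis_def)
    show ?thesis
      using N(1,2) by (cases j) (simp_all add: det_4 matrix_def ax power2_eq_square algebra_simps)
  qed
  also have "\<dots> > 0"
  proof -
    have "hopf_base x \<noteq> 0" by (simp add: hopf_base_def)
    then show ?thesis by (simp only: complex_neq_0 zero_less_power)
  qed
  finally show ?thesis .
qed

lemma hopf_dom_image:
  "(\<lambda>p. hopf_coords a (swap_to j p)) ` hopf_dom j a = {x. a < x $ 2 \<and> x $ 2 < a + 2 * pi}"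
proof (intro subset_antisym subsetI)
  fix x :: "real ^ 4" assume "x \<in> {x. a < x $ 2 \<and> x $ 2 < a + 2 * pi}"
  then show "x \<in> (\<lambda>p. hopf_coords a (swap_to j p)) ` hopf_dom j a"
    using hopf_coords_point[of a x]
    by (intro rev_image_eqI[of "swap_to j (hopf_point x)"]) (auto simp: hopf_dom_def)
next
  fix x assume "x \<in> (\<lambda>p. hopf_coords a (swap_to j p)) ` hopf_dom j a"
  then obtain p where p: "x = hopf_coords a (swap_to j p)" "fst (swap_to j p) \<in> slit a"
    unfolding hopf_dom_def by blast
  obtain z w where "swap_to j p = (z, w)" by fastforce
  with p have "x = hopf_coords a (z, w)" "z \<in> slit a" by auto
  then show "x \<in> {x. a < x $ 2 \<and> x $ 2 < a + 2 * pi}" using arg_branch by auto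
qed

text \<open>Links the abstract atlas of the ball to explicit formulas: \<open>hopf_dom j a\<close>
  is open in C^2, and \<open>ln |p| \<le> 0\<close> cuts out the ball there.\<close>

lemma hopf_chart_domain_atlas:
  "(hopf_dom j a \<inter> cball 0 1, \<lambda>p. hopf_coords a (swap_to j p)) \<in> domain_atlas (cball 0 1)"
proof -
  let ?W = "hopf_dom j a" and ?\<Phi> = "\<lambda>p. hopf_coords a (swap_to j p)"
  have W: "open ?W"
    unfolding hopf_dom_def vimage_def[symmetric]
    using open_vimage[OF open_slit continuous_on_fst[OF linear_continuous_on[OF bounded_linear_swap_to]]]
    by (simp add: vimage_def)
  let ?S = "c2_coords ` ?W" and ?T = "{x :: real ^ 4. a < x $ 2 \<and> x $ 2 < a + 2 * pi}"
  define z w where "z x = fst (swap_to j (c2_point x))" and "w x = snd (swap_to j (c2_point x))" for x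
  have S: "open ?S" by (rule open_c2_coords_image[OF W])
  have T: "open ?T" by (intro open_Collect_conj open_Collect_less continuous_intros)
  have zS: "z x \<in> slit a" if "x \<in> ?S" for x
    using that by (auto simp: z_def hopf_dom_def simp del: c2_coords.simps)
  have lin: "bounded_linear z" "bounded_linear w"
  proof -
    have "z = (\<lambda>x. case j of First \<Rightarrow> Complex (x $ 1) (x $ 2) | Second \<Rightarrow> Complex (x $ 3) (x $ 4))"
      "w = (\<lambda>x. case j of First \<Rightarrow> Complex (x $ 3) (x $ 4) | Second \<Rightarrow> Complex (x $ 1) (x $ 2))"
      by (cases j; simp add: z_def w_def c2_point_def fun_eq_iff)+
    then show "bounded_linear z" "bounded_linear w"
      by (cases j; simp add: bounded_linear_Complex_nth)+
  qed
  have sm: "smooth_on z ?S" "smooth_on w ?S"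
    by (intro smooth_on_linear S lin)+
  have q: "smooth_on (\<lambda>x. w x * inverse (z x)) ?S"
    using zS slit_nonzero by (intro smooth_on_mult smooth_on_inverse sm S) blast
  have nrm: "norm (c2_point x) = sqrt ((x $ 1)\<^sup>2 + (x $ 2)\<^sup>2 + (x $ 3)\<^sup>2 + (x $ 4)\<^sup>2)" for x
    by (simp add: c2_point_def norm_Pair cmod_power2)
  have nrm_pos: "norm (c2_point x) > 0" if "x \<in> ?S" for x
  proof -
    have "swap_to j (c2_point x) \<noteq> 0"
    proof
      assume "swap_to j (c2_point x) = 0"
      then have "z x = 0" by (simp add: z_def)
      with zS[OF that] slit_nonzero show False by blast
    qed
    then show ?thesis by (metis norm_swap_to zero_less_norm_iff)
  qed
  \<comment> \<open>To avoid differentiating the norm, \<open>ln |p|\<close> is written as half the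
    logarithm of a quadratic polynomial, which is positive because
    \<open>z \<noteq> 0\<close>.\<close>
  have "smooth_on (\<lambda>x :: real ^ 4. (1 / 2) * ln ((x $ 1 * x $ 1 + x $ 2 * x $ 2) + (x $ 3 * x $ 3 + x $ 4 * x $ 4))) ?S"
  proof (intro smooth_on_mult smooth_on_const smooth_on_ln smooth_on_add smooth_on_linear S bounded_linear_vec_nth)
    fix x :: "real ^ 4" assume "x \<in> ?S"
    from nrm_pos[OF this] show "0 < (x $ 1 * x $ 1 + x $ 2 * x $ 2) + (x $ 3 * x $ 3 + x $ 4 * x $ 4)"
      unfolding nrm by (simp add: power2_eq_square algebra_simps)
  qed
  then have ln: "smooth_on (\<lambda>x. ln (norm (c2_point x))) ?S"
  proof (rule smooth_on_cong[OF S, rotated])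
    fix x assume "x \<in> ?S"
    from nrm_pos[OF this] show "(1 / 2) * ln ((x $ 1 * x $ 1 + x $ 2 * x $ 2) + (x $ 3 * x $ 3 + x $ 4 * x $ 4))
        = ln (norm (c2_point x))"
      unfolding nrm by (simp add: ln_sqrt power2_eq_square algebra_simps)
  qed
  have F: "hopf_coords a (swap_to j (c2_point x)) = vector [ln (norm (c2_point x)), arg_branch a (z x),
      Re (w x * inverse (z x)), Im (w x * inverse (z x))]" for x
  proof -
    have "swap_to j (c2_point x) = (z x, w x)" by (simp add: z_def w_def)
    moreover from this have "norm (z x, w x) = norm (c2_point x)" by (metis norm_swap_to)
    ultimately show ?thesis by (simp add: divide_inverse)
  qed
  have smF: "smooth_on (\<lambda>x. hopf_coords a (swap_to j (c2_point x))) ?S"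
  proof (rule smooth_on_vec[OF S])
    have "smooth_on (\<lambda>x. arg_branch a (z x)) ?S"
      using zS by (intro smooth_on_arg_branch S sm) auto
    then show "smooth_on (\<lambda>x. hopf_coords a (swap_to j (c2_point x)) $ i) ?S" for i
      using exhaust_4[of i] ln smooth_on_bounded_linear[OF S bounded_linear_Re q]
        smooth_on_bounded_linear[OF S bounded_linear_Im q]
      by (auto simp: F)
  qed
  have sc: "smooth_on hopf_scale ?T"
  proof -
    have "smooth_on (\<lambda>x :: real ^ 4. x $ 1 + (- 1 / 2) * ln (1 + (x $ 3 * x $ 3 + x $ 4 * x $ 4))) ?T"
      by (intro smooth_on_mult smooth_on_const smooth_on_ln smooth_on_add smooth_on_linear T
          bounded_linear_vec_nth) (simp add: add_pos_nonneg)
    then show ?thesis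
      by (rule smooth_on_cong[OF T, rotated]) (simp add: hopf_scale_def power2_eq_square algebra_simps)
  qed
  have base: "smooth_on hopf_base ?T"
    unfolding hopf_base_def[abs_def]
    by (intro smooth_on_exp smooth_on_add smooth_on_mult smooth_on_const T sc
        smooth_on_bounded_linear[OF _ bounded_linear_of_real] smooth_on_linear bounded_linear_vec_nth)
  have "smooth_on (\<lambda>x. hopf_base x * Complex (x $ 3) (x $ 4)) ?T"
    by (intro smooth_on_mult base T smooth_on_linear bounded_linear_Complex_nth)
  then have smG: "smooth_on (\<lambda>x. c2_coords (swap_to j (hopf_point x))) ?T"
    using smooth_on_c2_coords[OF T] base by (cases j) (simp_all add: hopf_point_def del: c2_coords.simps)
  have "oriented_atlas ?W {(?W, c2_coords), (?W, ?\<Phi>)}"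
  proof (rule oriented_atlas_pairI[OF S _ smF])
    show "open (?\<Phi> ` ?W)" "smooth_on (\<lambda>x. c2_coords (swap_to j (hopf_point x))) (?\<Phi> ` ?W)"
      using T smG by (simp_all only: hopf_dom_image)
    show "c2_coords (swap_to j (hopf_point (?\<Phi> p))) = c2_coords p" if "p \<in> ?W" for p
      using that by (simp add: hopf_dom_def hopf_point_coords)
  qed (simp_all add: inj_c2_coords jacobian_det_hopf_point)
  moreover have "?\<Phi> ` (?W \<inter> cball 0 1) = ?\<Phi> ` ?W \<inter> half_space"
  proof -
    have "?\<Phi> p \<in> half_space \<longleftrightarrow> p \<in> cball 0 1" if "p \<in> ?W" for p
    proof -
      obtain z w where zw: "swap_to j p = (z, w)" by fastforce
      with that have "z \<noteq> 0" using slit_nonzero by (auto simp: hopf_dom_def)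
      then have "norm (z, w) > 0" by (simp add: norm_Pair add_pos_nonneg)
      moreover have "norm (z, w) = norm p" by (metis zw norm_swap_to)
      ultimately show ?thesis by (simp add: half_space_def zw ln_le_zero_iff)
    qed
    then show ?thesis by blast
  qed
  ultimately show ?thesis unfolding domain_atlas_def using W by blast
qed

subsection \<open>Charts of the real oriented blow-up\<close>

text \<open>Uses a real lift \<open>t\<close> of the angle, which makes the chart formulas explicit;
  \<open>r = 0\<close> gives the boundary points.\<close>

definition rob_pt :: "chart_index \<Rightarrow> real \<Rightarrow> real \<Rightarrow> complex \<Rightarrow> local_pt set" where
  "rob_pt j r t v = rob_rel `` {(j, of_real r * cis t, v, to_angle t)}"

lemma rob_pt_local: "0 \<le> r \<Longrightarrow> (of_real r * cis t, v, to_angle t) \<in> rob_local"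
  by (simp add: rob_local_iff norm_mult cis_angle_to_angle)

lemma rob_coords_class:
  assumes "(u, v, \<theta>) \<in> rob_local"
  shows "rob_coords j (rob_rel `` {(j, u, v, \<theta>)}) = (u, v, \<theta>)"
  unfolding rob_coords_def
proof (rule the_equality)
  show "(j, u, v, \<theta>) \<in> rob_rel `` {(j, u, v, \<theta>)}"
    using assms by (simp add: rob_rel_def)
  fix q assume "(j, q) \<in> rob_rel `` {(j, u, v, \<theta>)}"
  then show "q = (u, v, \<theta>)"
    by (cases q) (auto simp: rob_rel_def blowup_pt_eq(1))
qed

lemma rob_coords_rob_pt: "0 \<le> r \<Longrightarrow> rob_coords j (rob_pt j r t v) = (of_real r * cis t, v, to_angle t)"
  unfolding rob_pt_def by (rule rob_coords_class[OF rob_pt_local])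

lemma rob_class_eq:
  assumes "p \<in> rob" "(j, u, v, \<theta>) \<in> p"
  shows "p = rob_rel `` {(j, u, v, \<theta>)}" "(u, v, \<theta>) \<in> rob_local"
proof -
  obtain q where q: "p = rob_rel `` {q}"
    using assms(1) unfolding rob_def by (auto elim: quotientE)
  with assms have rel: "(q, (j, u, v, \<theta>)) \<in> rob_rel" by simp
  then show "p = rob_rel `` {(j, u, v, \<theta>)}"
    unfolding q by (rule equiv_class_eq[OF equiv_rob_rel])
  from rel show "(u, v, \<theta>) \<in> rob_local" by (auto simp: rob_rel_def)
qed

lemma rob_chart_dom_eq:
  "rob_chart_dom j a = {rob_pt j r t v | r t v. 0 \<le> r \<and> a < t \<and> t < a + 2 * pi}"
proof (intro subset_antisym subsetI)
  fix p assume "p \<in> rob_chart_dom j a"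
  then obtain u v t where p: "p \<in> rob" "(j, u, v, to_angle t) \<in> p" "a < t" "t < a + 2 * pi"
    by (auto simp: rob_chart_dom_def)
  then have "u = of_real (cmod u) * cis t"
    using rob_class_eq(2)[OF p(1,2)] by (simp add: rob_local_iff cis_angle_to_angle)
  then have "p = rob_pt j (cmod u) t v"
    using rob_class_eq(1)[OF p(1,2)] by (simp add: rob_pt_def)
  with p show "p \<in> {rob_pt j r t v | r t v. 0 \<le> r \<and> a < t \<and> t < a + 2 * pi}"
    using norm_ge_zero by blast
next
  fix p assume "p \<in> {rob_pt j r t v | r t v. 0 \<le> r \<and> a < t \<and> t < a + 2 * pi}"
  then obtain r t v where p: "p = rob_pt j r t v" "0 \<le> r" "a < t" "t < a + 2 * pi" by blast
  have "p \<in> rob" unfolding p(1) rob_pt_def rob_def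
    using rob_pt_local[OF p(2)] by (intro quotientI) auto
  moreover have "(j, of_real r * cis t, v, to_angle t) \<in> p"
    unfolding p(1) rob_pt_def using rob_pt_local[OF p(2)]
    by (intro equiv_class_self[OF equiv_rob_rel]) auto
  moreover have "to_angle t \<in> to_angle ` {a<..<a + 2 * pi}" using p(3,4) by simp
  ultimately show "p \<in> rob_chart_dom j a" unfolding rob_chart_dom_def by blast
qed

lemma rob_pt_in_rob_boundary:
  assumes "0 \<le> r"
  shows "rob_pt j r t v \<in> rob_boundary \<longleftrightarrow> r = 0"
proof
  assume "rob_pt j r t v \<in> rob_boundary"
  then obtain k u' v' \<theta>' where
    "(k, u', v', \<theta>') \<in> rob_pt j r t v" "blowup_pt k (u', v') \<in> exceptional_divisor"
    by (auto simp: rob_boundary_def)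
  then have "blowup_pt j (of_real r * cis t, v) \<in> exceptional_divisor"
    by (auto simp: rob_pt_def rob_rel_def)
  then show "r = 0" by (simp add: exceptional_divisor_iff)
next
  assume "r = 0"
  then show "rob_pt j r t v \<in> rob_boundary"
    by (auto simp: rob_boundary_eq rob_pt_def boundary_pt_def)
qed

lemma rob_chart_interior_eq:
  "rob_chart_dom j a - rob_boundary = {rob_pt j r t v | r t v. 0 < r \<and> a < t \<and> t < a + 2 * pi}"
proof (intro subset_antisym subsetI)
  fix p assume p: "p \<in> rob_chart_dom j a - rob_boundary"
  then obtain r t v where "p = rob_pt j r t v" "0 \<le> r" "a < t" "t < a + 2 * pi"
    unfolding rob_chart_dom_eq by blast
  moreover from this p have "r \<noteq> 0" by (auto simp: rob_pt_in_rob_boundary)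
  ultimately show "p \<in> {rob_pt j r t v | r t v. 0 < r \<and> a < t \<and> t < a + 2 * pi}"
    using less_le by blast
next
  fix p assume "p \<in> {rob_pt j r t v | r t v. 0 < r \<and> a < t \<and> t < a + 2 * pi}"
  then obtain r t v where p: "p = rob_pt j r t v" "0 < r" "a < t" "t < a + 2 * pi" by blast
  then have "p \<in> rob_chart_dom j a" unfolding rob_chart_dom_eq using less_imp_le by blast
  with p show "p \<in> rob_chart_dom j a - rob_boundary" by (simp add: rob_pt_in_rob_boundary)
qed

lemma rob_chart_rob_pt:
  assumes "0 \<le> r" "a < t" "t < a + 2 * pi"
  shows "rob_chart j a \<sigma> (rob_pt j r t v) = vector [- r, \<sigma> * t, Re v, Im v]"
  using assms by (simp add: rob_chart_def rob_coords_rob_pt norm_mult angle_branch_to_angle)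

lemma complex_coords_rob_pt:
  "0 \<le> r \<Longrightarrow> complex_coords j (rob_pt j r t v) = c2_coords (of_real r * cis t, v)"
  by (simp add: complex_coords_def rob_coords_rob_pt del: c2_coords.simps)

text \<open>Inverts \<open>rob_chart\<close>: there \<open>r = - x $ 1\<close>, and
  \<open>t = \<sigma> * x $ 2\<close> because \<open>\<sigma> * \<sigma> = 1\<close>.\<close>

definition polar_point :: "real \<Rightarrow> real ^ 4 \<Rightarrow> complex \<times> complex" where
  "polar_point \<sigma> x = (of_real (- (x $ 1)) * exp (of_real (\<sigma> * x $ 2) * \<i>), Complex (x $ 3) (x $ 4))"

lemma polar_point_rob_chart:
  assumes "\<sigma> * \<sigma> = 1" "0 \<le> r" "a < t" "t < a + 2 * pi"
  shows "c2_coords (polar_point \<sigma> (rob_chart j a \<sigma> (rob_pt j r t v))) = complex_coords j (rob_pt j r t v)"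
  using assms by (simp add: polar_point_def rob_chart_rob_pt complex_coords_rob_pt cis_conv_exp
      mult.commute mult.left_commute mult.assoc[symmetric] del: c2_coords.simps)

text \<open>The polar Jacobian \<open>r = - x $ 1\<close>, multiplied by \<open>- 1\<close> for the
  sign of the first coordinate and by \<open>\<sigma>\<close> for that of the second. As
  \<open>x $ 1 < 0\<close> off the boundary, it is positive there for \<open>\<sigma> = - 1\<close>
  and negative for \<open>\<sigma> = 1\<close>.\<close>

lemma jacobian_det_polar_point: "jacobian_det (\<lambda>x. c2_coords (polar_point \<sigma> x)) x = \<sigma> * x $ 1"
proof -
  let ?E = "exp (of_real (\<sigma> * x $ 2) * \<i>)"
  let ?U = "\<lambda>h. of_real (- (x $ 1)) * (?E * (of_real (\<sigma> * h $ 2) * \<i>)) + of_real (- (h $ 1)) * ?E"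
  have nth: "((\<lambda>x :: real ^ 4. x $ i) has_derivative (\<lambda>h. h $ i)) (at x)" for i
    by (rule bounded_linear_imp_has_derivative[OF bounded_linear_vec_nth])
  have "((\<lambda>x :: real ^ 4. of_real (\<sigma> * x $ 2) * \<i>) has_derivative (\<lambda>h. of_real (\<sigma> * h $ 2) * \<i>)) (at x)"
    by (intro has_derivative_mult_left has_derivative_mult_right nth
        bounded_linear.has_derivative[OF bounded_linear_of_real])
  from has_derivative_compose[OF this DERIV_exp[unfolded has_field_derivative_def]]
  have "((\<lambda>x :: real ^ 4. of_real (- (x $ 1)) * exp (of_real (\<sigma> * x $ 2) * \<i>)) has_derivative ?U) (at x)"
    by (intro has_derivative_mult has_derivative_minus nth
        bounded_linear.has_derivative[OF bounded_linear_of_real])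
  then have "((\<lambda>x. c2_coords (polar_point \<sigma> x)) has_derivative
      (\<lambda>h. c2_coords (?U h, Complex (h $ 3) (h $ 4)))) (at x)"
    unfolding polar_point_def
    by (intro bounded_linear.has_derivative[OF bounded_linear_c2_coords] has_derivative_Pair
        bounded_linear_imp_has_derivative[OF bounded_linear_Complex_nth])
  then have "jacobian_det (\<lambda>x. c2_coords (polar_point \<sigma> x)) x =
      det (matrix (\<lambda>h. c2_coords (?U h, Complex (h $ 3) (h $ 4))))"
    by (rule jacobian_det_eq)
  also have "\<dots> = \<sigma> * x $ 1 * ((Re ?E)\<^sup>2 + (Im ?E)\<^sup>2)"
  proof -
    have ax: "axis i (1 :: real) $ k = (if k = i then 1 else 0)" for i k :: 4 by (simp add: axis_def)
    show ?thesis
      by (simp add: det_4 matrix_def ax power2_eq_square algebra_simps del: Re_exp Im_exp)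
  qed
  also have "(Re ?E)\<^sup>2 + (Im ?E)\<^sup>2 = 1"
    by (simp add: cmod_power2[symmetric])
  finally show ?thesis by simp
qed

lemma rob_chart_image:
  assumes "\<sigma> * \<sigma> = 1"
  shows "rob_chart j a \<sigma> ` (rob_chart_dom j a - rob_boundary) =
    {x. x $ 1 < 0 \<and> a < \<sigma> * x $ 2 \<and> \<sigma> * x $ 2 < a + 2 * pi}"
proof (intro subset_antisym subsetI)
  fix x assume "x \<in> rob_chart j a \<sigma> ` (rob_chart_dom j a - rob_boundary)"
  then obtain r t v where x: "x = rob_chart j a \<sigma> (rob_pt j r t v)" "0 < r" "a < t" "t < a + 2 * pi"
    unfolding rob_chart_interior_eq by blast
  then have eq: "x = vector [- r, \<sigma> * t, Re v, Im v]" by (simp add: rob_chart_rob_pt)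
  show "x \<in> {x. x $ 1 < 0 \<and> a < \<sigma> * x $ 2 \<and> \<sigma> * x $ 2 < a + 2 * pi}"
    unfolding eq using x(2-4) assms by (simp add: mult.assoc[symmetric])
next
  fix x :: "real ^ 4" assume x: "x \<in> {x. x $ 1 < 0 \<and> a < \<sigma> * x $ 2 \<and> \<sigma> * x $ 2 < a + 2 * pi}"
  let ?p = "rob_pt j (- (x $ 1)) (\<sigma> * x $ 2) (Complex (x $ 3) (x $ 4))"
  have "?p \<in> rob_chart_dom j a - rob_boundary"
    unfolding rob_chart_interior_eq using x by - (rule CollectI, intro exI conjI, rule refl, auto)
  moreover have "rob_chart j a \<sigma> ?p = x"
    using x assms by (simp add: rob_chart_rob_pt vec_eq_iff forall_4 mult.assoc[symmetric])
  ultimately show "x \<in> rob_chart j a \<sigma> ` (rob_chart_dom j a - rob_boundary)"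
    by (metis image_eqI)
qed

lemma complex_coords_image:
  "complex_coords j ` (rob_chart_dom j a - rob_boundary) = {x. Complex (x $ 1) (x $ 2) \<in> slit a}"
proof (intro subset_antisym subsetI)
  fix x assume "x \<in> complex_coords j ` (rob_chart_dom j a - rob_boundary)"
  then obtain r t v where x: "x = complex_coords j (rob_pt j r t v)" "0 < r" "a < t" "t < a + 2 * pi"
    unfolding rob_chart_interior_eq by blast
  then have "x = c2_coords (of_real r * cis t, v)"
    by (simp add: complex_coords_rob_pt del: c2_coords.simps)
  then have "Complex (x $ 1) (x $ 2) = of_real r * cis t" by (simp add: complex_eq_iff)
  with polar_slit(1)[OF x(2-4)] show "x \<in> {x. Complex (x $ 1) (x $ 2) \<in> slit a}" by simp
next
  fix x :: "real ^ 4" assume x: "x \<in> {x. Complex (x $ 1) (x $ 2) \<in> slit a}"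
  let ?u = "Complex (x $ 1) (x $ 2)"
  let ?p = "rob_pt j (cmod ?u) (arg_branch a ?u) (Complex (x $ 3) (x $ 4))"
  have s: "?u \<in> slit a" using x by simp
  then have "0 < cmod ?u" using slit_nonzero[of ?u a] by (simp only: zero_less_norm_iff) blast
  then have "?p \<in> rob_chart_dom j a - rob_boundary"
    unfolding rob_chart_interior_eq using arg_branch[OF s] by blast
  moreover have "complex_coords j ?p = x"
    using arg_branch(3)[OF s] by (simp only: complex_coords_rob_pt norm_ge_zero) (simp add: vec_eq_iff forall_4)
  ultimately show "x \<in> complex_coords j ` (rob_chart_dom j a - rob_boundary)"
    by (metis image_eqI)
qed

lemma rob_chart_oriented:
  "oriented_atlas (rob_chart_dom j a - rob_boundary)
     {(rob_chart_dom j a - rob_boundary, complex_coords j),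
      (rob_chart_dom j a - rob_boundary, rob_chart j a (- 1))}"
proof -
  let ?V = "rob_chart_dom j a - rob_boundary" and ?\<psi> = "rob_chart j a (- 1)"
  let ?S = "{x :: real ^ 4. Complex (x $ 1) (x $ 2) \<in> slit a}"
    and ?T = "{x :: real ^ 4. x $ 1 < 0 \<and> a < (- 1) * x $ 2 \<and> (- 1) * x $ 2 < a + 2 * pi}"
  let ?u = "\<lambda>x :: real ^ 4. Complex (x $ 1) (x $ 2)"
  let ?F = "\<lambda>x :: real ^ 4. vector [- cmod (?u x), - arg_branch a (?u x), x $ 3, x $ 4] :: real ^ 4"
  have S: "open ?S"
    using open_vimage[OF open_slit linear_continuous_on[OF bounded_linear_Complex_nth]]
    by (simp add: vimage_def)
  have T: "open ?T" by (intro open_Collect_conj open_Collect_less continuous_intros)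
  have u: "smooth_on ?u ?S" by (intro smooth_on_linear S bounded_linear_Complex_nth)
  have neg: "smooth_on (\<lambda>x. - f x) ?S" if "smooth_on f ?S" for f :: "real ^ 4 \<Rightarrow> real"
    using smooth_on_bounded_linear[OF S bounded_linear_minus[OF bounded_linear_ident] that] .
  \<comment> \<open>Writing the modulus as \<open>u\<close> times the exponential of
    \<open>- i arg u\<close> derives its smoothness from that of \<open>exp\<close> and
    \<open>arg_branch\<close>.\<close>
  have "smooth_on (\<lambda>x. Re (?u x * exp (of_real (arg_branch a (?u x)) * (- \<i>)))) ?S"
    by (intro smooth_on_bounded_linear[OF _ bounded_linear_Re] smooth_on_mult smooth_on_exp S u
        smooth_on_const smooth_on_bounded_linear[OF _ bounded_linear_of_real] smooth_on_arg_branch) auto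
  then have "smooth_on (\<lambda>x. cmod (?u x)) ?S"
  proof (rule smooth_on_cong[OF S, rotated])
    fix x :: "real ^ 4" assume "x \<in> ?S"
    then have "?u x * cis (- arg_branch a (?u x)) = of_real (cmod (?u x)) * (cis (arg_branch a (?u x)) * cis (- arg_branch a (?u x)))"
      using arg_branch(3)[of "?u x" a] by (simp only: mem_Collect_eq mult.assoc[symmetric])
    then show "Re (?u x * exp (of_real (arg_branch a (?u x)) * (- \<i>))) = cmod (?u x)"
      by (simp only: cis_mult) (simp add: cis_conv_exp mult.commute)
  qed
  moreover have "smooth_on (\<lambda>x. arg_branch a (?u x)) ?S"
    by (intro smooth_on_arg_branch S u) auto
  ultimately have smF: "smooth_on ?F ?S"
  proof (intro smooth_on_vec[OF S])
    fix i :: 4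
    assume "smooth_on (\<lambda>x. cmod (?u x)) ?S" "smooth_on (\<lambda>x. arg_branch a (?u x)) ?S"
    then show "smooth_on (\<lambda>x. ?F x $ i) ?S"
      using exhaust_4[of i] smooth_on_linear[OF S bounded_linear_vec_nth] by (auto intro: neg)
  qed
  have "smooth_on (\<lambda>x :: real ^ 4. of_real (- (x $ 1)) * exp (of_real ((- 1) * x $ 2) * \<i>)) ?T"
    by (intro smooth_on_mult smooth_on_exp smooth_on_bounded_linear[OF _ bounded_linear_of_real]
        smooth_on_const T smooth_on_linear bounded_linear_minus bounded_linear_vec_nth)
  then have smG: "smooth_on (\<lambda>x. c2_coords (polar_point (- 1) x)) ?T"
    unfolding polar_point_def
    by (rule smooth_on_c2_coords[OF T _ smooth_on_linear[OF T bounded_linear_Complex_nth]])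
  have F: "?F (complex_coords j p) = ?\<psi> p" if "p \<in> ?V" for p
  proof -
    obtain r t v where p: "p = rob_pt j r t v" "0 < r" "a < t" "t < a + 2 * pi"
      using \<open>p \<in> ?V\<close> unfolding rob_chart_interior_eq by blast
    have "?u (complex_coords j p) = of_real r * cis t" and "complex_coords j p $ 3 = Re v" "complex_coords j p $ 4 = Im v"
      using p by (simp_all add: complex_coords_rob_pt complex_eq_iff)
    then show ?thesis
      using polar_slit(2)[OF p(2-4)] p by (simp add: rob_chart_rob_pt norm_mult)
  qed
  have G: "c2_coords (polar_point (- 1) (?\<psi> p)) = complex_coords j p" if "p \<in> ?V" for p
    using that polar_point_rob_chart[of "- 1"] unfolding rob_chart_interior_eq by auto
  have "inj_on ?\<psi> ?V"
  proof (rule inj_onI)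
    fix p q assume "p \<in> ?V" "q \<in> ?V" and eq: "?\<psi> p = ?\<psi> q"
    then obtain r t v r' t' v' where pq: "p = rob_pt j r t v" "0 < r" "a < t" "t < a + 2 * pi"
        "q = rob_pt j r' t' v'" "0 < r'" "a < t'" "t' < a + 2 * pi"
      unfolding rob_chart_interior_eq by blast
    with eq have "r = r'" "t = t'" "v = v'"
      by (simp_all add: rob_chart_rob_pt vec_eq_iff forall_4 complex_eq_iff)
    with pq show "p = q" by simp
  qed
  then have "inj_on (complex_coords j) ?V"
    using F by (metis (mono_tags, lifting) inj_on_def)
  moreover have "jacobian_det (\<lambda>x. c2_coords (polar_point (- 1) x)) (?\<psi> p) > 0" if "p \<in> ?V" for p
    using that rob_chart_image[of "- 1" j a] by (auto simp: jacobian_det_polar_point)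
  ultimately show ?thesis
    using S T smF smG F G
    by (intro oriented_atlas_pairI[where F = ?F and G = "\<lambda>x. c2_coords (polar_point (- 1) x)"])
      (simp_all only: complex_coords_image rob_chart_image minus_mult_minus mult_1)
qed

text \<open>Excludes the sign \<open>1\<close> from \<open>rob_atlas\<close>; a single point with
  negative Jacobian is enough.\<close>

lemma rob_chart_not_oriented:
  "\<not> oriented_atlas (rob_chart_dom j a - rob_boundary)
     {(rob_chart_dom j a - rob_boundary, complex_coords j),
      (rob_chart_dom j a - rob_boundary, rob_chart j a 1)}"
proof
  let ?V = "rob_chart_dom j a - rob_boundary" and ?\<psi> = "rob_chart j a 1"
  let ?T = "{x :: real ^ 4. x $ 1 < 0 \<and> a < 1 * x $ 2 \<and> 1 * x $ 2 < a + 2 * pi}"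
  let ?G = "\<lambda>x. c2_coords (polar_point 1 x)" and ?H = "local_rep (?V, ?\<psi>) (?V, complex_coords j) id"
  assume "oriented_atlas ?V {(?V, complex_coords j), (?V, ?\<psi>)}"
  then have c: "compatible (?V, ?\<psi>) (?V, complex_coords j)" "inj_on ?\<psi> ?V"
    by (simp_all add: oriented_atlas_iff)
  have im: "?\<psi> ` ?V = ?T" by (rule rob_chart_image) simp
  \<comment> \<open>The point with \<open>r = 1\<close>, the angle in the middle of its interval,
    and \<open>v = 0\<close>; the Jacobian there is \<open>- 1\<close>.\<close>
  define x where "x = (vector [- 1, a + pi, 0, 0] :: real ^ 4)"
  have x: "x \<in> ?T" by (simp add: x_def)
  have dom: "rep_dom (?V, ?\<psi>) (?V, complex_coords j) id = ?T"
    unfolding rep_dom_id by (simp only: Int_absorb im)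
  have pos: "jacobian_det ?H x > 0" and sm: "smooth_on ?H ?T" and op: "open ?T"
    using c(1) x unfolding compatible_def dom by auto
  have "?H y = ?G y" if "y \<in> ?T" for y
  proof -
    obtain r t v where y: "y = ?\<psi> (rob_pt j r t v)" "0 < r" "a < t" "t < a + 2 * pi"
      using \<open>y \<in> ?T\<close> unfolding im[symmetric] rob_chart_interior_eq by blast
    then have "rob_pt j r t v \<in> ?V" unfolding rob_chart_interior_eq by blast
    then show ?thesis
      using polar_point_rob_chart[of 1 r a t j v] y c(2) by (simp add: local_rep_chart)
  qed
  moreover have "?H differentiable at x"
    using smooth_on_has_derivative[OF sm x] by (rule differentiableI)
  ultimately have "jacobian_det ?H x = jacobian_det ?G x"
    by (intro jacobian_det_cong[OF op x])
  also have "\<dots> = - 1" by (simp add: jacobian_det_polar_point x_def)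
  finally show False using pos by simp
qed

lemma rob_atlas_eq: "rob_atlas = range (\<lambda>(j, a). (rob_chart_dom j a, rob_chart j a (- 1)))"
proof -
  have "rob_atlas = {(rob_chart_dom j a, rob_chart j a (- 1)) | j a. True}"
    unfolding rob_atlas_def using rob_chart_oriented rob_chart_not_oriented by blast
  then show ?thesis by (simp add: image_def split_paired_Ex)
qed

section \<open>Explicit charts of the boundary of the blow-up\<close>

definition boundary_chart_dom :: "chart_index \<Rightarrow> real \<Rightarrow> local_pt set set" where
  "boundary_chart_dom j a = {boundary_pt j v (to_angle t) | v t. a < t \<and> t < a + 2 * pi}"

text \<open>The minus sign is that of \<open>opposite_atlas\<close>; it cancels the one from
  \<open>\<sigma> = - 1\<close> and leaves \<open>(t, Re v, Im v)\<close>.\<close>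

definition boundary_coords_chart :: "chart_index \<Rightarrow> real \<Rightarrow> local_pt set \<Rightarrow> real ^ 3" where
  "boundary_coords_chart j a p =
    vector [- (rob_chart j a (- 1) p $ 2), rob_chart j a (- 1) p $ 3, rob_chart j a (- 1) p $ 4]"

lemma rob_boundary_atlas_eq:
  "rob_boundary_atlas = range (\<lambda>(j, a). (boundary_chart_dom j a, boundary_coords_chart j a))"
proof -
  have "{p \<in> rob_chart_dom j a. rob_chart j a (- 1) p $ 1 = 0} = boundary_chart_dom j a" for j a
  proof (intro subset_antisym subsetI)
    fix p assume "p \<in> {p \<in> rob_chart_dom j a. rob_chart j a (- 1) p $ 1 = 0}"
    then obtain r t v where p: "p = rob_pt j r t v" "0 \<le> r" "a < t" "t < a + 2 * pi"
        "rob_chart j a (- 1) p $ 1 = 0"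
      unfolding rob_chart_dom_eq by blast
    then have "r = 0" by (simp add: rob_chart_rob_pt)
    with p show "p \<in> boundary_chart_dom j a"
      unfolding boundary_chart_dom_def by (auto simp: rob_pt_def boundary_pt_def)
  next
    fix p assume "p \<in> boundary_chart_dom j a"
    then obtain t v where p: "p = rob_pt j 0 t v" "a < t" "t < a + 2 * pi"
      unfolding boundary_chart_dom_def by (auto simp: rob_pt_def boundary_pt_def)
    then have "p \<in> rob_chart_dom j a" unfolding rob_chart_dom_eq by blast
    with p show "p \<in> {p \<in> rob_chart_dom j a. rob_chart j a (- 1) p $ 1 = 0}"
      by (simp add: rob_chart_rob_pt)
  qed
  then show ?thesis
    unfolding rob_boundary_atlas_def opposite_atlas_def boundary_atlas_eq rob_atlas_eq image_image
    by (simp add: split_beta boundary_chart_def boundary_coords_chart_def[abs_def])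
qed

lemma boundary_coords_chart_pt:
  assumes "a < t" "t < a + 2 * pi"
  shows "boundary_coords_chart j a (boundary_pt j v (to_angle t)) = vector [t, Re v, Im v]"
proof -
  have "boundary_pt j v (to_angle t) = rob_pt j 0 t v" by (simp add: boundary_pt_def rob_pt_def)
  with assms show ?thesis by (simp add: boundary_coords_chart_def rob_chart_rob_pt)
qed

subsection \<open>Transport of an atlas along a bijection\<close>

text \<open>The conclusion is unfolded so that it serves \<open>smooth_map\<close> and
  \<open>orientation_preserving\<close> at once, with \<open>f\<close> a map, its inverse, or the
  identity.\<close>

lemma same_rep:
  assumes "compatible c' d'" "rep_dom c d f = rep_dom c' d' id"
    and "\<And>x. x \<in> rep_dom c' d' id \<Longrightarrow> local_rep c' d' id x = local_rep c d f x"
  shows "open (rep_dom c d f) \<and> smooth_on (local_rep c d f) (rep_dom c d f) \<and>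
    (\<forall>x\<in>rep_dom c d f. det (matrix (frechet_derivative (local_rep c d f) (at x))) > 0)"
proof -
  let ?S = "rep_dom c' d' id" and ?F = "local_rep c' d' id"
  have c: "open ?S" "smooth_on ?F ?S" "\<And>x. x \<in> ?S \<Longrightarrow> jacobian_det ?F x > 0"
    using assms(1) by (auto simp: compatible_def)
  have "jacobian_det (local_rep c d f) x > 0" if "x \<in> ?S" for x
  proof -
    have "?F differentiable at x" using smooth_on_has_derivative[OF c(2) that] by (rule differentiableI)
    then show ?thesis using jacobian_det_cong[OF c(1) that assms(3)] c(3)[OF that] by simp
  qed
  then show ?thesis
    using c(1) smooth_on_cong[OF c(1) assms(3) c(2)] unfolding assms(2) jacobian_det_def by blast
qed

text \<open>If each chart of \<open>B\<close>, pulled back along \<open>f\<close>, is a chart of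
  \<open>A\<close>, then \<open>f\<close>, its inverse and the transitions within \<open>B\<close>
  all have transitions within \<open>A\<close> as local representatives. Thus \<open>B\<close> need
  not be known to be an atlas beforehand.\<close>

lemma transport_atlas:
  assumes A: "oriented_atlas M A" and bij: "bij_betw f M N" and cover: "\<Union>(fst ` B) = N"
    and pull: "\<And>d. d \<in> B \<Longrightarrow> \<exists>e\<in>A. fst e = M \<inter> f -` fst d \<and> (\<forall>p\<in>fst e. snd e p = snd d (f p))"
  shows "oriented_atlas N B" "diffeomorphism M A N B f" "orientation_preserving A B f"
proof -
  have subM: "fst c \<subseteq> M" and injA: "inj_on (snd c) (fst c)" if "c \<in> A" for c
    using A that by (auto simp: oriented_atlas_iff)
  have comp: "compatible c d" if "c \<in> A" "d \<in> A" for c d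
    using A that by (simp add: oriented_atlas_iff)
  have inj: "inj_on f M" and onto: "f ` M = N" using bij by (auto simp: bij_betw_def)
  have inv: "inv_into M f (f p) = p" if "p \<in> M" for p
    using inj that by simp
  define e where "e d = (SOME e. e \<in> A \<and> fst e = M \<inter> f -` fst d \<and> (\<forall>p\<in>fst e. snd e p = snd d (f p)))" for d
  have e: "e d \<in> A" "fst (e d) = M \<inter> f -` fst d" "\<And>p. p \<in> fst (e d) \<Longrightarrow> snd (e d) p = snd d (f p)"
    if "d \<in> B" for d
    using someI_ex[of "\<lambda>e. e \<in> A \<and> fst e = M \<inter> f -` fst d \<and> (\<forall>p\<in>fst e. snd e p = snd d (f p))"] pull[OF that]
    unfolding e_def[symmetric] by blast+
  have domB: "fst d = f ` fst (e d)" if "d \<in> B" for d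
  proof -
    have "fst d \<subseteq> f ` M" using cover that onto by blast
    then show ?thesis unfolding e(2)[OF that] by blast
  qed
  have injB: "inj_on (snd d) (fst d)" if "d \<in> B" for d
  proof -
    have "inj_on (snd d \<circ> f) (fst (e d))"
      using injA[OF e(1)[OF that]] e(3)[OF that] by (simp add: inj_on_def)
    then show ?thesis unfolding domB[OF that] by (rule inj_on_imageI)
  qed
  have locA: "the_inv_into (fst c) (snd c) (snd c p) = p" if "c \<in> A" "p \<in> fst c" for c p
    using injA that by (simp add: the_inv_into_f_f)
  have locB: "the_inv_into (fst d) (snd d) (snd (e d) p) = f p" if "d \<in> B" "p \<in> fst (e d)" for d p
    using injB[OF that(1)] domB[OF that(1)] that by (simp add: the_inv_into_f_f e(3))
  have imB: "snd d ` (f ` S) = snd (e d) ` S" if "d \<in> B" "S \<subseteq> fst (e d)" for d S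
    using e(3)[OF that(1)] that(2) by (force simp: image_image)
  have AB: "open (rep_dom c d f) \<and> smooth_on (local_rep c d f) (rep_dom c d f) \<and>
    (\<forall>x\<in>rep_dom c d f. det (matrix (frechet_derivative (local_rep c d f) (at x))) > 0)"
    if "c \<in> A" "d \<in> B" for c d
  proof (rule same_rep[OF comp[OF that(1) e(1)[OF that(2)]]])
    show "rep_dom c d f = rep_dom c (e d) id"
      using subM[OF that(1)] by (auto simp: rep_dom_def e(2)[OF that(2)])
    show "local_rep c (e d) id x = local_rep c d f x" if "x \<in> rep_dom c (e d) id" for x
      using that \<open>c \<in> A\<close> e(3)[OF \<open>d \<in> B\<close>] by (auto simp: rep_dom_def local_rep_def locA)
  qed
  have BA: "open (rep_dom d c (inv_into M f)) \<and>
    smooth_on (local_rep d c (inv_into M f)) (rep_dom d c (inv_into M f)) \<and>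
    (\<forall>x\<in>rep_dom d c (inv_into M f).
       det (matrix (frechet_derivative (local_rep d c (inv_into M f)) (at x))) > 0)"
    if "c \<in> A" "d \<in> B" for c d
  proof (rule same_rep[OF comp[OF e(1)[OF that(2)] that(1)]])
    have "fst d \<inter> inv_into M f -` fst c = f ` (fst (e d) \<inter> fst c)"
      using domB[OF that(2)] subM[OF e(1)[OF that(2)]] by (auto simp: inv subsetD)
    then show "rep_dom d c (inv_into M f) = rep_dom (e d) c id"
      using imB[OF that(2)] by (simp add: rep_dom_def)
    show "local_rep (e d) c id x = local_rep d c (inv_into M f) x" if "x \<in> rep_dom (e d) c id" for x
      using that e(1)[OF \<open>d \<in> B\<close>] subM[OF e(1)[OF \<open>d \<in> B\<close>]]
      by (auto simp: rep_dom_def local_rep_def locA locB[OF \<open>d \<in> B\<close>] inv subsetD)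
  qed
  have BB: "open (rep_dom d d' id) \<and> smooth_on (local_rep d d' id) (rep_dom d d' id) \<and>
    (\<forall>x\<in>rep_dom d d' id. det (matrix (frechet_derivative (local_rep d d' id) (at x))) > 0)"
    if "d \<in> B" "d' \<in> B" for d d'
  proof (rule same_rep[OF comp[OF e(1)[OF that(1)] e(1)[OF that(2)]]])
    have "fst (e d) \<inter> fst (e d') = fst (e d) \<inter> f -` fst d'"
      unfolding e(2)[OF that(1)] e(2)[OF that(2)] by blast
    then have "fst d \<inter> fst d' = f ` (fst (e d) \<inter> fst (e d'))"
      unfolding domB[OF that(1)] by auto
    then show "rep_dom d d' id = rep_dom (e d) (e d') id"
      using imB[OF that(1)] by (simp add: rep_dom_def)
    show "local_rep (e d) (e d') id x = local_rep d d' id x" if "x \<in> rep_dom (e d) (e d') id" for x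
      using that e(1)[OF \<open>d \<in> B\<close>] e(3)[OF \<open>d' \<in> B\<close>]
      by (auto simp: rep_dom_def local_rep_def locA locB[OF \<open>d \<in> B\<close>])
  qed
  show "oriented_atlas N B"
    using cover injB BB unfolding oriented_atlas_def smooth_map_def orientation_preserving_def by blast
  show "diffeomorphism M A N B f"
    using bij AB BA unfolding diffeomorphism_def smooth_map_def by blast
  show "orientation_preserving A B f"
    using AB unfolding orientation_preserving_def by blast
qed

subsection \<open>The Hopf fibration and the boundary of the blow-up\<close>

text \<open>Compatibility comes from the general facts on straightening charts; the Hopf charts
  serve to cover the sphere.\<close>

lemma S3_oriented_atlas: "oriented_atlas S3 S3_atlas"
proof -
  have "fst c \<subseteq> S3" if "c \<in> S3_atlas" for c
    using that domain_boundary_subset_frontier unfolding S3_atlas_def boundary_atlas_eq S3_eq_sphere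
    by (fastforce simp: cball_diff_eq_sphere)
  moreover have "p \<in> \<Union>(fst ` S3_atlas)" if "p \<in> S3" for p
  proof -
    obtain z w where zw: "p = (z, w)" by (cases p)
    have n: "norm p = 1" using that by (simp add: S3_eq_sphere)
    then have "z \<noteq> 0 \<or> w \<noteq> 0" by (auto simp: zw)
    then obtain j where j: "fst (swap_to j p) \<noteq> 0"
      unfolding zw by (metis swap_to.simps fst_conv)
    \<comment> \<open>This rotates the nonzero coordinate onto the positive real axis, opposite to
      the slit.\<close>
    define a where "a = Arg (fst (swap_to j p)) - pi"
    have "fst (swap_to j p) * cis (- (a + pi)) = of_real (cmod (fst (swap_to j p)))"
    proof -
      have "fst (swap_to j p) = of_real (cmod (fst (swap_to j p))) * cis (Arg (fst (swap_to j p)))"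
        using j by (simp add: cis_Arg sgn_eq)
      then have "fst (swap_to j p) * cis (- (a + pi)) = of_real (cmod (fst (swap_to j p))) *
          (cis (Arg (fst (swap_to j p))) * cis (- (a + pi)))"
        by (metis mult.assoc)
      then show ?thesis by (simp only: cis_mult) (simp add: a_def)
    qed
    then have "p \<in> hopf_dom j a" using j by (simp add: hopf_dom_def slit_def)
    moreover have "hopf_coords a (swap_to j p) $ 1 = 0"
    proof -
      obtain x y where "swap_to j p = (x, y)" by fastforce
      moreover from this have "norm (x, y) = 1" using n by (metis norm_swap_to)
      ultimately show ?thesis by simp
    qed
    ultimately have "p \<in> fst (boundary_chart (hopf_dom j a \<inter> cball 0 1, \<lambda>p. hopf_coords a (swap_to j p)))"
      using n by (simp add: boundary_chart_def)
    then show ?thesis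
      unfolding S3_atlas_def boundary_atlas_eq using hopf_chart_domain_atlas by blast
  qed
  moreover have "inj_on (snd c) (fst c)" if "c \<in> S3_atlas" for c
  proof -
    from that obtain d where d: "c = boundary_chart d" "d \<in> domain_atlas (cball 0 1)"
      unfolding S3_atlas_def boundary_atlas_eq by blast
    from d(2) obtain W \<Phi> where "d = (W \<inter> cball 0 1, \<Phi>)" "inj_on \<Phi> W"
      by (rule domain_atlasD) blast
    then show ?thesis unfolding d(1) by (auto intro!: inj_on_boundary_chart inj_on_subset[of \<Phi> W])
  qed
  moreover have "compatible c d" if "c \<in> S3_atlas" "d \<in> S3_atlas" for c d
    using that domain_boundary_compatible by (auto simp: S3_atlas_def boundary_atlas_eq)
  ultimately show ?thesis unfolding oriented_atlas_iff by blast
qed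

lemma arg_divide: "z \<noteq> 0 \<Longrightarrow> w \<noteq> 0 \<Longrightarrow> arg w = arg z + arg (w / z)"
  using arg_mult[of z "w / z"] by simp

text \<open>Shows that the two cases of the map agree on the overlap although
  \<open>sphere_map\<close> prefers the first: \<open>arg w = arg z + arg (w / z)\<close> is the
  gluing rule for the angles.\<close>

lemma sphere_map_eq:
  assumes "p \<in> S3" "fst (swap_to j p) \<noteq> 0"
  shows "sphere_map p = boundary_pt j (snd (swap_to j p) / fst (swap_to j p)) (arg (fst (swap_to j p)))"
proof -
  obtain z w where p: "p = (z, w)" by (cases p)
  show ?thesis
  proof (cases j)
    case First
    then show ?thesis using assms(2) by (simp add: p)
  next
    case Second
    then show ?thesis
      using assms(2) arg_divide[of z w] by (auto simp: p boundary_pt_eq)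
  qed
qed

lemma sphere_map_eq_boundary_pt_iff:
  assumes "p \<in> S3"
  shows "sphere_map p = boundary_pt j v \<theta> \<longleftrightarrow>
    fst (swap_to j p) \<noteq> 0 \<and> v = snd (swap_to j p) / fst (swap_to j p) \<and> \<theta> = arg (fst (swap_to j p))"
proof (cases "fst (swap_to j p) = 0")
  case False
  then show ?thesis using sphere_map_eq[OF assms False] by (auto simp: boundary_pt_eq)
next
  \<comment> \<open>The image then has \<open>v = 0\<close> in the other chart, and such points lie
    outside chart \<open>j\<close>.\<close>
  case True
  obtain z w where p: "p = (z, w)" by (cases p)
  have "z \<noteq> 0 \<or> w \<noteq> 0" using assms by (auto simp: S3_def p)
  with True show ?thesis
    using sphere_map_eq[OF assms, of First] sphere_map_eq[OF assms, of Second]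
    by (cases j) (auto simp: p boundary_pt_eq)
qed

lemma sphere_map_bij: "bij_betw sphere_map S3 rob_boundary"
proof (rule bij_betw_imageI)
  show "inj_on sphere_map S3"
  proof (rule inj_onI)
    fix p q assume p: "p \<in> S3" and q: "q \<in> S3" and eq: "sphere_map p = sphere_map q"
    obtain j where j: "fst (swap_to j p) \<noteq> 0"
    proof -
      obtain z w where zw: "p = (z, w)" by (cases p)
      then have "z \<noteq> 0 \<or> w \<noteq> 0" using p by (auto simp: S3_def)
      then show ?thesis using that[of First] that[of Second] by (auto simp: zw)
    qed
    obtain z w where zw: "swap_to j p = (z, w)" by fastforce
    obtain x y where xy: "swap_to j q = (x, y)" by fastforce
    have "sphere_map q = boundary_pt j (w / z) (arg z)"
      using sphere_map_eq[OF p j] eq zw by simp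
    then have e: "x \<noteq> 0" "w / z = y / x" "arg z = arg x"
      using xy by (simp_all add: sphere_map_eq_boundary_pt_iff[OF q])
    have z: "z \<noteq> 0" using j zw by simp
    have n: "norm (z, w) = 1" "norm (x, y) = 1"
      using p q zw xy by (metis S3_eq_sphere dist_0_norm mem_sphere norm_swap_to)+
    \<comment> \<open>Both sides are 1 by the equation of the sphere, so the common quotient
      determines the modulus.\<close>
    have "(cmod z)\<^sup>2 * (1 + (cmod (w / z))\<^sup>2) = (cmod x)\<^sup>2 * (1 + (cmod (y / x))\<^sup>2)"
      using n z e(1) by (simp add: norm_Pair norm_divide field_simps)
    moreover have "1 + (cmod (w / z))\<^sup>2 > 0" by (simp add: add_pos_nonneg)
    ultimately have "cmod z = cmod x" unfolding e(2) by simp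
    then have "z = x" using cis_angle_arg[OF z] cis_angle_arg[OF e(1)] e(3) by metis
    moreover from this e(2) z have "w = y" by simp
    ultimately show "p = q" using zw xy by (metis swap_to_swap_to)
  qed
  show "sphere_map ` S3 = rob_boundary"
  proof (intro subset_antisym subsetI)
    fix b assume "b \<in> sphere_map ` S3"
    then obtain z w where "b = sphere_map (z, w)" by auto
    then show "b \<in> rob_boundary"
      unfolding rob_boundary_eq by (cases "z = 0") (simp_all, blast+)
  next
    fix b assume "b \<in> rob_boundary"
    then obtain j v \<theta> where b: "b = boundary_pt j v \<theta>" by (auto simp: rob_boundary_eq)
    obtain t where t: "\<theta> = to_angle t" by (metis Quotient_angle Quotient_abs_rep)
    \<comment> \<open>The modulus forced by
      \<open>r\<^sup>2 * (1 + |v|\<^sup>2) = 1\<close>.\<close>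
    define r where "r = inverse (sqrt (1 + (cmod v)\<^sup>2))"
    have pos: "1 + (cmod v)\<^sup>2 > 0" by (simp add: add_pos_nonneg)
    then have r: "r > 0" "r\<^sup>2 * (1 + (cmod v)\<^sup>2) = 1"
      by (simp_all add: r_def power_inverse)
    define p where "p = swap_to j (of_real r * cis t, of_real r * cis t * v)"
    have "(norm p)\<^sup>2 = r\<^sup>2 * (1 + (cmod v)\<^sup>2)"
      by (simp add: p_def norm_Pair norm_mult power_mult_distrib algebra_simps)
    then have "p \<in> S3" using r(2) norm_ge_zero[of p] by (simp add: S3_eq_sphere power2_eq_1_iff)
    moreover from this have "sphere_map p = b"
      unfolding b using r(1) by (simp add: sphere_map_eq_boundary_pt_iff p_def arg_polar t)
    ultimately show "b \<in> sphere_map ` S3" by blast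
  qed
qed

lemma rob_boundary_cover: "\<Union>(fst ` rob_boundary_atlas) = rob_boundary"
proof (intro subset_antisym subsetI)
  fix b assume "b \<in> \<Union>(fst ` rob_boundary_atlas)"
  then show "b \<in> rob_boundary"
    by (auto simp: rob_boundary_atlas_eq boundary_chart_dom_def rob_boundary_eq)
next
  fix b assume "b \<in> rob_boundary"
  then obtain j v \<theta> where b: "b = boundary_pt j v \<theta>" by (auto simp: rob_boundary_eq)
  obtain t where t: "\<theta> = to_angle t" by (metis Quotient_angle Quotient_abs_rep)
  have "b \<in> boundary_chart_dom j (t - pi)"
    unfolding boundary_chart_dom_def b t using pi_gt_zero by force
  then show "b \<in> \<Union>(fst ` rob_boundary_atlas)" by (auto simp: rob_boundary_atlas_eq)
qed

text \<open>The pulled-back chart is the boundary restriction of the Hopf chart with the same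
  \<open>j\<close> and \<open>a\<close>: its last three coordinates are the lifted angle and the
  real and imaginary parts of \<open>w / z\<close>.\<close>

lemma rob_boundary_chart_pullback:
  assumes "d \<in> rob_boundary_atlas"
  shows "\<exists>e\<in>S3_atlas. fst e = S3 \<inter> sphere_map -` fst d \<and> (\<forall>p\<in>fst e. snd e p = snd d (sphere_map p))"
proof -
  obtain j a where d: "d = (boundary_chart_dom j a, boundary_coords_chart j a)"
    using assms by (auto simp: rob_boundary_atlas_eq)
  define e where "e = boundary_chart (hopf_dom j a \<inter> cball 0 1, \<lambda>p. hopf_coords a (swap_to j p))"
  have eA: "e \<in> S3_atlas"
    unfolding e_def S3_atlas_def boundary_atlas_eq using hopf_chart_domain_atlas by blast
  have fst_S3: "fst e = S3 \<inter> hopf_dom j a"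
  proof -
    have "hopf_coords a (swap_to j p) $ 1 = ln (norm p)" for p
      by (metis hopf_coords.simps norm_swap_to prod.collapse vector_4(1))
    \<comment> \<open>Excludes the origin, so that \<open>ln (norm p) = 0\<close> really means
      \<open>norm p = 1\<close>.\<close>
    moreover have "norm p > 0" if "p \<in> hopf_dom j a" for p
    proof -
      have "fst (swap_to j p) \<noteq> 0" using that slit_nonzero by (auto simp: hopf_dom_def)
      then have "swap_to j p \<noteq> 0" by auto
      then show ?thesis by (metis norm_swap_to zero_less_norm_iff)
    qed
    ultimately show ?thesis by (auto simp: e_def boundary_chart_def S3_eq_sphere)
  qed
  have mem: "p \<in> hopf_dom j a \<longleftrightarrow> sphere_map p \<in> boundary_chart_dom j a" if p: "p \<in> S3" for p
  proof
    assume "p \<in> hopf_dom j a"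
    then have s: "fst (swap_to j p) \<in> slit a" by (simp add: hopf_dom_def)
    then show "sphere_map p \<in> boundary_chart_dom j a"
      using sphere_map_eq[OF p slit_nonzero[OF s]] arg_branch(1,2)[OF s] arg_slit[OF s]
      unfolding boundary_chart_dom_def by auto
  next
    assume "sphere_map p \<in> boundary_chart_dom j a"
    then obtain v t where "sphere_map p = boundary_pt j v (to_angle t)" "a < t" "t < a + 2 * pi"
      by (auto simp: boundary_chart_dom_def)
    then have z: "fst (swap_to j p) \<noteq> 0" "arg (fst (swap_to j p)) = to_angle t" "a < t" "t < a + 2 * pi"
      by (simp_all add: sphere_map_eq_boundary_pt_iff[OF p])
    have "fst (swap_to j p) = of_real (cmod (fst (swap_to j p))) * cis t"
      using cis_angle_arg[OF z(1)] z(2) by (simp add: cis_angle_to_angle)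
    then show "p \<in> hopf_dom j a"
      using polar_slit(1)[OF _ z(3,4), of "cmod (fst (swap_to j p))"] z(1) by (simp add: hopf_dom_def)
  qed
  have "snd e p = snd d (sphere_map p)" if "p \<in> fst e" for p
  proof -
    have p: "p \<in> S3" and s: "fst (swap_to j p) \<in> slit a"
      using that fst_S3 by (auto simp: hopf_dom_def)
    obtain z w where zw: "swap_to j p = (z, w)" by fastforce
    have "sphere_map p = boundary_pt j (w / z) (to_angle (arg_branch a z))"
      using sphere_map_eq[OF p slit_nonzero[OF s]] arg_slit[OF s] zw by simp
    then show ?thesis
      using arg_branch(1,2)[OF s] zw
      by (simp add: d e_def boundary_chart_def boundary_coords_chart_pt vec_eq_iff forall_3)
  qed
  moreover have "fst e = S3 \<inter> sphere_map -` fst d"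
    unfolding fst_S3 d using mem by auto
  ultimately show ?thesis using eA by blast
qed

theorem mainTheorem4:
  shows "oriented_atlas S3 S3_atlas \<and> oriented_atlas rob_boundary rob_boundary_atlas \<and>
    (\<forall>z1 z2. (z1, z2) \<in> S3 \<longrightarrow>
      (z1 \<noteq> 0 \<longrightarrow> sphere_map (z1, z2) = boundary_pt First (z2 / z1) (arg z1)) \<and>
      (z2 \<noteq> 0 \<longrightarrow> sphere_map (z1, z2) = boundary_pt Second (z1 / z2) (arg z2))) \<and>
    diffeomorphism S3 S3_atlas rob_boundary rob_boundary_atlas sphere_map \<and>
    orientation_preserving S3_atlas rob_boundary_atlas sphere_map \<and>
    (\<forall>\<Theta>. \<forall>z\<in>S3. sphere_map (hopf_action \<Theta> z) = canonical_action \<Theta> (sphere_map z))"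
proof (intro conjI allI ballI impI)
  note transport = transport_atlas[OF S3_oriented_atlas sphere_map_bij rob_boundary_cover
      rob_boundary_chart_pullback]
  show "oriented_atlas S3 S3_atlas" by (rule S3_oriented_atlas)
  show "oriented_atlas rob_boundary rob_boundary_atlas"
    "diffeomorphism S3 S3_atlas rob_boundary rob_boundary_atlas sphere_map"
    "orientation_preserving S3_atlas rob_boundary_atlas sphere_map"
    by (rule transport; assumption)+
  show "sphere_map (z1, z2) = boundary_pt First (z2 / z1) (arg z1)" if "z1 \<noteq> 0" for z1 z2
    using that by simp
  show "sphere_map (z1, z2) = boundary_pt Second (z1 / z2) (arg z2)"
    if "(z1, z2) \<in> S3" "z2 \<noteq> 0" for z1 z2
    using sphere_map_eq[of "(z1, z2)" Second] that by simp
  fix \<Theta> z assume "z \<in> S3"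
  obtain z1 z2 where z: "z = (z1, z2)" by (cases z)
  have nz: "cis_angle \<Theta> \<noteq> 0" using norm_cis_angle[of \<Theta>] by force
  \<comment> \<open>The Hopf action leaves the quotient of the coordinates fixed, so only the angle
    has to be followed.\<close>
  have arg: "arg (cis_angle \<Theta> * w) = arg w + \<Theta>" if "w \<noteq> 0" for w
  proof -
    have "arg (cis_angle \<Theta>) = \<Theta>"
      using cis_angle_arg[OF nz] by (simp add: norm_cis_angle cis_angle_inj)
    then show ?thesis using arg_mult[OF nz that] by (simp add: add.commute)
  qed
  have "z1 \<noteq> 0 \<or> z2 \<noteq> 0" using \<open>z \<in> S3\<close> by (auto simp: S3_def z)
  then show "sphere_map (hopf_action \<Theta> z) = canonical_action \<Theta> (sphere_map z)"
    using nz by (auto simp: z canonical_action_boundary_pt arg)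
qed

end
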